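(* For every $p\in(1,2]$ there exist a constant $c_p\in(0,2)$ and a sequence $\eta_n\to0$ (both depending only on $p$) such that for every $n\in\mathbb{N}$, every $\mathbf{k}$ as below, and every $\lambda\in(2^{-n},c_p^{-n}]$, $$g_{p,\mathbf{k},n}(\lambda)\ \ge\ \Big(\frac{\big(\log2+\frac1n\log\lambda\big)^2}{2}+\eta_n\Big)\frac{n^2}{2^n}.$$
   Context: $\log$ is the natural logarithm. $\mathbf{k}=(k_1,\dots,k_{m+1})$ integers with $0=k_1<\cdots<k_{m+1}=n$. For $\mathbf{x}\in\mathbb{R}^n$ put $\mathbf{x}_j=(x_{k_j+1},\dots,x_{k_{j+1}})$, $\|\mathbf{x}\|_{p,\mathbf{k},n}=(\sum_{j=1}^m\|\mathbf{x}_j\|_2^p)^{1/p}$ ($\|\cdot\|_2$ Euclidean norm), $d(\mathbf{x},\mathbf{y})=\|\mathbf{y}-\mathbf{x}\|_{p,\mathbf{k},n}$, $B(\mathbf{x},r)=\{\mathbf{y}:d(\mathbf{x},\mathbf{y})\le r\}$, and $r_n$ is the radius with $\mathrm{vol}(B(\mathbf 0,r_n))=1$. For bounded measurable $S\subseteq\mathbb{R}^n$ and integer $t\ge1$ let $\hat Z_S(t)=\frac1{t!}\int_{S^t}\mathbf 1[d(\mathbf{x}_i,\mathbf{x}_j)\ge2r_n\ \forall i\ne j]\,d\mathbf{x}_1\cdots d\mathbf{x}_t$, $\hat Z_S(0)=1$, and $Z_S(\lambda)=\sum_{t\ge0}\lambda^t\hat Z_S(t)$. With $V=V(R)=\mathrm{vol}(B(\mathbf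 0,R))=(R/r_n)^n$, the pressure is $g_{p,\mathbf{k},n}(\lambda)=\lim_{R\to\infty}\frac1V\log Z_{B(\mathbf 0,R)}(\lambda)$ (if the limit does not exist, interpret it as the $\liminf$). *)

theory Defs
  imports "HOL-Analysis.Analysis" "HOL-Probability.Probability"
begin

text \<open>Points of R^n are represented as extensional functions on {..<n}; Lebesgue
measure on R^n is the product measure of n copies of lborel.
Block structure: k 0 = 0 < k 1 < ... < k m = n (0-indexed version of the paper's
k_1 < ... < k_{m+1}); block j (j < m) consists of coordinates k j <= i < k (Suc j).\<close>

definition lebn :: "nat \<Rightarrow> (nat \<Rightarrow> real) measure" where
  "lebn n = PiM {..<n} (\<lambda>_. lborel)"

definition valid_k :: "nat \<Rightarrow> nat \<Rightarrow> (nat \<Rightarrow> nat) \<Rightarrow> bool" where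
  "valid_k n m k \<longleftrightarrow> k 0 = 0 \<and> k m = n \<and> (\<forall>j<m. k j < k (Suc j))"

definition blocknorm :: "real \<Rightarrow> nat \<Rightarrow> (nat \<Rightarrow> nat) \<Rightarrow> (nat \<Rightarrow> real) \<Rightarrow> real" where
  "blocknorm p m k x =
     (\<Sum>j<m. (sqrt (\<Sum>i\<in>{k j..<k (Suc j)}. (x i)\<^sup>2)) powr p) powr (1 / p)"

definition bdist :: "real \<Rightarrow> nat \<Rightarrow> (nat \<Rightarrow> nat) \<Rightarrow> (nat \<Rightarrow> real) \<Rightarrow> (nat \<Rightarrow> real) \<Rightarrow> real" where
  "bdist p m k x y = blocknorm p m k (\<lambda>i. y i - x i)"

definition bball :: "real \<Rightarrow> nat \<Rightarrow> nat \<Rightarrow> (nat \<Rightarrow> nat) \<Rightarrow> (nat \<Rightarrow> real) \<Rightarrow> real \<Rightarrow> (nat \<Rightarrow> real) set" where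
  "bball p n m k x r = {y \<in> space (lebn n). bdist p m k x y \<le> r}"

definition origin :: "nat \<Rightarrow> nat \<Rightarrow> real" where
  "origin n = (\<lambda>i. if i < n then 0 else undefined)"

definition bvol :: "nat \<Rightarrow> (nat \<Rightarrow> real) set \<Rightarrow> real" where
  "bvol n S = measure (lebn n) S"

definition rad :: "real \<Rightarrow> nat \<Rightarrow> nat \<Rightarrow> (nat \<Rightarrow> nat) \<Rightarrow> real" where
  "rad p n m k = (THE r. 0 < r \<and> bvol n (bball p n m k (origin n) r) = 1)"

definition Zhat :: "real \<Rightarrow> nat \<Rightarrow> nat \<Rightarrow> (nat \<Rightarrow> nat) \<Rightarrow> (nat \<Rightarrow> real) set \<Rightarrow> nat \<Rightarrow> real" where
  "Zhat p n m k S t =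
     (if t = 0 then 1 else
      measure (PiM {..<t} (\<lambda>_. lebn n))
        {xs \<in> space (PiM {..<t} (\<lambda>_. lebn n)).
           (\<forall>i<t. xs i \<in> S) \<and>
           (\<forall>i<t. \<forall>j<t. i \<noteq> j \<longrightarrow> bdist p m k (xs i) (xs j) \<ge> 2 * rad p n m k)}
      / fact t)"

definition Zpart :: "real \<Rightarrow> nat \<Rightarrow> nat \<Rightarrow> (nat \<Rightarrow> nat) \<Rightarrow> (nat \<Rightarrow> real) set \<Rightarrow> real \<Rightarrow> real" where
  "Zpart p n m k S lam = (\<Sum>t. lam ^ t * Zhat p n m k S t)"

text \<open>Pressure, as a liminf (equals the limit when it exists).\<close>
definition pressure :: "real \<Rightarrow> nat \<Rightarrow> nat \<Rightarrow> (nat \<Rightarrow> nat) \<Rightarrow> real \<Rightarrow> ereal" where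
  "pressure p n m k lam =
     Liminf at_top (\<lambda>R::real. ereal
       (ln (Zpart p n m k (bball p n m k (origin n) R) lam)
         / bvol n (bball p n m k (origin n) R)))"

end

theory Submission
  imports Defs
begin

text \<open>
Discretise. Put a fine cubic grid on the ball \<open>B(0,R)\<close> and join two grid points when their distance
is below \<open>2 r\<^sub>n\<close> plus two cell diameters: any choice of points in the cells of an independent set is
then admissible, so \<open>Z\<close> at fugacity \<open>\<lambda>\<close> dominates the independence polynomial of the grid graph at
fugacity \<open>\<mu> = \<lambda> \<epsilon>\<^sup>n\<close>. This graph has degrees at most about \<open>\<Delta> = 2\<^sup>n / \<epsilon>\<^sup>n\<close>, and by uniform convexity
of the norm (uniform in the block structure, since \<open>p > 1\<close>) its neighbourhoods are sparse: the average
degree inside any part of a neighbourhood is at most a constant times \<open>(2 \<beta>)\<^sup>n / \<epsilon>\<^sup>n\<close> with \<open>\<beta> < 1\<close>.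
For \<open>\<lambda> \<le> (1 + \<beta>)\<^sup>-\<^sup>n\<close> the fugacity is thus too small for edges inside neighbourhoods to matter.

In such a graph, reveal a random independent set outside the neighbourhood of a vertex \<open>v\<close> and let \<open>T\<close> be
the set of neighbours that remain free. If \<open>T\<close> tends to be small then \<open>v\<close> is often unoccupied by
neighbours, hence often available; if \<open>T\<close> tends to be large then many neighbours of \<open>v\<close> are occupied.
Balancing the two, the expected density is at least about \<open>w / \<Delta>\<close> where \<open>w e\<^sup>w = \<mu> \<Delta>\<close>; integrating over the logarithm
of the fugacity from \<open>\<mu> \<Delta> = 1\<close> on gives \<open>(log (2\<^sup>n \<lambda>))\<^sup>2 / 2\<close> to leading order.
\<close>

section \<open>Independent sets in locally sparse graphs\<close>

text \<open>Adjacency is reflexive, so \<open>{x. E u x}\<close> is the closed neighbourhood of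
  \<open>u\<close>; deleting it deletes \<open>u\<close> as well.\<close>

locale hardcore_graph =
  fixes E :: "'a \<Rightarrow> 'a \<Rightarrow> bool"
  assumes E_refl: "E a a" and E_sym: "E a b \<Longrightarrow> E b a"
begin

definition indep_sets :: "'a set \<Rightarrow> 'a set set" where
  "indep_sets V = {A. A \<subseteq> V \<and> (\<forall>a\<in>A. \<forall>b\<in>A. a \<noteq> b \<longrightarrow> \<not> E a b)}"

definition Z :: "'a set \<Rightarrow> real \<Rightarrow> real" where
  "Z V \<mu> = (\<Sum>A\<in>indep_sets V. \<mu> ^ card A)"

text \<open>In the hard-core model with weights \<open>\<mu> ^ card A\<close>, the quotient
  \<open>M V \<mu> / Z V \<mu>\<close> is the expected size of the random independent set;
  \<open>M V \<mu>\<close> is also \<open>\<mu>\<close> times the derivative of \<open>Z V\<close>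
  at \<open>\<mu>\<close>.\<close>

definition M :: "'a set \<Rightarrow> real \<Rightarrow> real" where
  "M V \<mu> = (\<Sum>A\<in>indep_sets V. real (card A) * \<mu> ^ card A)"

lemma finite_indep_sets: "finite V \<Longrightarrow> finite (indep_sets V)"
  unfolding indep_sets_def by (rule finite_subset[of _ "Pow V"]) auto

lemma indep_sets_finite: "finite V \<Longrightarrow> A \<in> indep_sets V \<Longrightarrow> finite A"
  unfolding indep_sets_def by (auto intro: finite_subset)

lemma empty_indep: "{} \<in> indep_sets V"
  by (simp add: indep_sets_def)

lemma Z_ge_1: "finite V \<Longrightarrow> 0 \<le> \<mu> \<Longrightarrow> 1 \<le> Z V \<mu>"
  unfolding Z_def using member_le_sum[of "{}" "indep_sets V" "\<lambda>A. \<mu> ^ card A"]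
  by (simp add: empty_indep finite_indep_sets)

lemma Z_mono:
  assumes "finite V" "0 \<le> \<mu>" "\<mu> \<le> \<nu>" shows "Z V \<mu> \<le> Z V \<nu>"
  unfolding Z_def using assms by (intro sum_mono power_mono) auto

text \<open>Dropping the independence condition leaves the generating function of all subsets,
  \<open>(1 + \<mu>) ^ card T\<close>.\<close>

lemma Z_le_exp:
  assumes "finite T" "0 \<le> \<mu>"
  shows "Z T \<mu> \<le> exp (\<mu> * real (card T))"
proof -
  have "Z T \<mu> \<le> (\<Sum>A\<in>Pow T. \<mu> ^ card A)"
    unfolding Z_def using assms by (intro sum_mono2) (auto simp: indep_sets_def)
  also have "\<dots> = (\<Sum>A\<in>Pow T. (\<Prod>a\<in>A. \<mu>) * (\<Prod>a\<in>T-A. 1))"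
    by simp
  also have "\<dots> = (\<Prod>a\<in>T. \<mu> + 1)"
    using assms by (subst prod_add) auto
  also have "\<dots> = (1 + \<mu>) ^ card T"
    by (simp add: add.commute)
  also have "\<dots> \<le> exp \<mu> ^ card T"
    using assms by (intro power_mono) (auto simp: exp_ge_add_one_self)
  finally show ?thesis
    by (simp add: exp_of_nat_mult[symmetric] mult.commute)
qed

text \<open>Deleting \<open>u\<close> is a bijection onto the independent sets that avoid the closed
  neighbourhood of \<open>u\<close>; the vertex \<open>u\<close> contributes the factor
  \<open>\<mu>\<close>.\<close>

lemma sum_indep_containing:
  assumes "finite V" "u \<in> V"
  shows "(\<Sum>A\<in>{A\<in>indep_sets V. u \<in> A}. \<mu> ^ card A) = \<mu> * Z (V - {x. E u x}) \<mu>"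
proof -
  have "(\<Sum>A\<in>{A\<in>indep_sets V. u \<in> A}. \<mu> ^ card A)
      = (\<Sum>B\<in>indep_sets (V - {x. E u x}). \<mu> * \<mu> ^ card B)"
  proof (rule sum.reindex_bij_witness[where i = "insert u" and j = "\<lambda>A. A - {u}"])
    fix A assume A: "A \<in> {A \<in> indep_sets V. u \<in> A}"
    then show "insert u (A - {u}) = A" by auto
    show "A - {u} \<in> indep_sets (V - {x. E u x})"
      using A by (auto simp: indep_sets_def)
    have "finite A" using A assms indep_sets_finite by auto
    then have "card A = Suc (card (A - {u}))" using A by (metis (lifting) card.remove mem_Collect_eq)
    then show "\<mu> * \<mu> ^ card (A - {u}) = \<mu> ^ card A" by simp
  next
    fix B assume B: "B \<in> indep_sets (V - {x. E u x})"
    then have "u \<notin> B" using E_refl by (auto simp: indep_sets_def)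
    then show "insert u B - {u} = B" by auto
    show "insert u B \<in> {A \<in> indep_sets V. u \<in> A}"
      using B assms E_sym by (auto simp: indep_sets_def)
  qed
  then show ?thesis by (simp add: Z_def sum_distrib_left)
qed

text \<open>Double counting of pairs of an independent set and one of its members.\<close>

lemma M_eq:
  assumes "finite V"
  shows "M V \<mu> = \<mu> * (\<Sum>u\<in>V. Z (V - {x. E u x}) \<mu>)"
proof -
  have "M V \<mu> = (\<Sum>A\<in>indep_sets V. \<Sum>u\<in>V. if u \<in> A then \<mu> ^ card A else 0)"
    unfolding M_def
  proof (rule sum.cong[OF refl])
    fix A assume "A \<in> indep_sets V"
    then have "V \<inter> A = A" by (auto simp: indep_sets_def)
    then show "real (card A) * \<mu> ^ card A = (\<Sum>u\<in>V. if u \<in> A then \<mu> ^ card A else 0)"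
      using assms by (simp add: sum.inter_restrict[symmetric])
  qed
  also have "\<dots> = (\<Sum>u\<in>V. \<Sum>A\<in>{A\<in>indep_sets V. u \<in> A}. \<mu> ^ card A)"
    using assms finite_indep_sets by (subst sum.swap) (simp add: sum.inter_filter[symmetric])
  also have "\<dots> = (\<Sum>u\<in>V. \<mu> * Z (V - {x. E u x}) \<mu>)"
    using assms by (intro sum.cong refl sum_indep_containing) auto
  finally show ?thesis by (simp add: sum_distrib_left)
qed

lemma Z_subset_mono: "finite V \<Longrightarrow> W \<subseteq> V \<Longrightarrow> 0 \<le> \<mu> \<Longrightarrow> Z W \<mu> \<le> Z V \<mu>"
  unfolding Z_def by (intro sum_mono2 finite_indep_sets) (auto simp: indep_sets_def)

text \<open>Union bound: an independent set that meets \<open>B\<close> contains some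
  \<open>x\<close> in \<open>V \<inter> B\<close>, and the sets containing \<open>x\<close> have
  total weight at most \<open>\<mu> * Z V \<mu>\<close>.\<close>

lemma Z_remove_ge:
  assumes "finite V" "0 \<le> \<mu>"
  shows "Z V \<mu> - \<mu> * real (card (V \<inter> B)) * Z V \<mu> \<le> Z (V - B) \<mu>"
proof -
  have "Z V \<mu> \<le> (\<Sum>A\<in>indep_sets V. (if A \<inter> B = {} then \<mu> ^ card A else 0) +
      (\<Sum>x\<in>V \<inter> B. if x \<in> A then \<mu> ^ card A else 0))"
    unfolding Z_def
  proof (rule sum_mono)
    fix A assume A: "A \<in> indep_sets V"
    show "\<mu> ^ card A \<le> (if A \<inter> B = {} then \<mu> ^ card A else 0) +
      (\<Sum>x\<in>V \<inter> B. if x \<in> A then \<mu> ^ card A else 0)"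
    proof (cases "A \<inter> B = {}")
      case True
      then show ?thesis using assms by (auto intro!: sum_nonneg)
    next
      case False
      then obtain x where "x \<in> A" "x \<in> B" by auto
      moreover from this have "x \<in> V" using A by (auto simp: indep_sets_def)
      ultimately show ?thesis
        using False assms member_le_sum[of x "V \<inter> B" "\<lambda>x. if x \<in> A then \<mu> ^ card A else 0"] by auto
    qed
  qed
  also have "\<dots> = (\<Sum>A\<in>{A\<in>indep_sets V. A \<inter> B = {}}. \<mu> ^ card A) +
      (\<Sum>x\<in>V \<inter> B. \<Sum>A\<in>{A\<in>indep_sets V. x \<in> A}. \<mu> ^ card A)"
    using finite_indep_sets[OF assms(1)]
    by (simp only: sum.distrib sum.swap[of _ "V \<inter> B" "indep_sets V"] sum.inter_filter)
  also have "{A\<in>indep_sets V. A \<inter> B = {}} = indep_sets (V - B)"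
    by (auto simp: indep_sets_def)
  also have "(\<Sum>x\<in>V \<inter> B. \<Sum>A\<in>{A\<in>indep_sets V. x \<in> A}. \<mu> ^ card A) = (\<Sum>x\<in>V \<inter> B. \<mu> * Z (V - {y. E x y}) \<mu>)"
    using assms by (intro sum.cong refl sum_indep_containing) auto
  also have "\<dots> \<le> (\<Sum>x\<in>V \<inter> B. \<mu> * Z V \<mu>)"
    using assms by (intro sum_mono mult_left_mono Z_subset_mono) auto
  finally show ?thesis by (simp add: Z_def[of "V - B"] algebra_simps)
qed

text \<open>Expand with \<open>M_eq\<close> and remove each closed neighbourhood with
  \<open>Z_remove_ge\<close>. The relative loss is at most \<open>\<mu>\<close> times the number of
  adjacent ordered pairs in \<open>T\<close>, so a sparse \<open>T\<close> costs only the factor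
  \<open>\<theta>\<close>.\<close>

lemma M_ge_sparse:
  assumes "finite T" "0 \<le> \<mu>"
    and "real (\<Sum>u\<in>T. card (T \<inter> {x. E u x})) \<le> D * real (card T)"
    and "\<theta> \<le> 1 - \<mu> * D"
  shows "\<theta> * (\<mu> * real (card T)) * Z T \<mu> \<le> M T \<mu>"
proof -
  have Z0: "0 \<le> Z T \<mu>" using Z_ge_1[OF assms(1,2)] by simp
  have "\<theta> * real (card T) \<le> real (card T) - \<mu> * (D * real (card T))"
    using mult_right_mono[OF assms(4), of "real (card T)"] by (simp add: algebra_simps)
  also have "\<dots> \<le> real (card T) - \<mu> * real (\<Sum>u\<in>T. card (T \<inter> {x. E u x}))"
    using mult_left_mono[OF assms(3) assms(2)] by simp
  finally have "\<theta> * real (card T) * Z T \<mu>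
      \<le> (real (card T) - \<mu> * real (\<Sum>u\<in>T. card (T \<inter> {x. E u x}))) * Z T \<mu>"
    using Z0 by (rule mult_right_mono)
  also have "\<dots> = (\<Sum>u\<in>T. Z T \<mu> - \<mu> * real (card (T \<inter> {x. E u x})) * Z T \<mu>)"
    by (simp add: sum_subtractf sum_distrib_left sum_distrib_right algebra_simps)
  also have "\<dots> \<le> (\<Sum>u\<in>T. Z (T - {x. E u x}) \<mu>)"
    using assms by (intro sum_mono Z_remove_ge)
  finally have "\<mu> * (\<theta> * real (card T) * Z T \<mu>) \<le> M T \<mu>"
    unfolding M_eq[OF assms(1)] using assms(2) by (rule mult_left_mono)
  then show ?thesis by (simp only: mult_ac)
qed

section \<open>Conditioning on the configuration outside a neighbourhood\<close>

definition free :: "'a set \<Rightarrow> 'a set \<Rightarrow> 'a set" where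
  "free U J = {u\<in>U. \<forall>j\<in>J. \<not> E u j}"

text \<open>Spatial Markov property: an independent set of \<open>V\<close> is an independent
  \<open>J\<close> outside \<open>U\<close> together with an independent subset of the vertices of
  \<open>U\<close> that \<open>J\<close> leaves free.\<close>

lemma sum_indep_split:
  assumes "finite V" "U \<subseteq> V"
  shows "(\<Sum>A\<in>indep_sets V. f (A - U) (A \<inter> U))
       = (\<Sum>J\<in>indep_sets (V - U). \<Sum>K\<in>indep_sets (free U J). f J K)"
proof -
  have fin: "finite (indep_sets (free U J))" for J
    using assms by (intro finite_indep_sets) (auto simp: free_def intro: finite_subset)
  have "(\<Sum>J\<in>indep_sets (V - U). \<Sum>K\<in>indep_sets (free U J). f J K)
      = (\<Sum>(J,K)\<in>Sigma (indep_sets (V - U)) (\<lambda>J. indep_sets (free U J)). f J K)"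
    using assms fin by (intro sum.Sigma finite_indep_sets) auto
  also have "\<dots> = (\<Sum>A\<in>indep_sets V. f (A - U) (A \<inter> U))"
  proof (rule sum.reindex_bij_witness[where j = "\<lambda>(J,K). J \<union> K" and i = "\<lambda>A. (A - U, A \<inter> U)"])
    fix A assume "A \<in> indep_sets V"
    then show "(A - U, A \<inter> U) \<in> Sigma (indep_sets (V - U)) (\<lambda>J. indep_sets (free U J))"
      by (auto simp: indep_sets_def free_def)
  next
    fix a assume a: "a \<in> Sigma (indep_sets (V - U)) (\<lambda>J. indep_sets (free U J))"
    then obtain J K where JK: "a = (J, K)" "J \<in> indep_sets (V - U)" "K \<in> indep_sets (free U J)"
      by auto
    then have *: "(J \<union> K) - U = J" "(J \<union> K) \<inter> U = K"
      by (auto simp: indep_sets_def free_def)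
    show "((case a of (J,K) \<Rightarrow> J \<union> K) - U, (case a of (J,K) \<Rightarrow> J \<union> K) \<inter> U) = a"
      using * JK by simp
    show "(case a of (J,K) \<Rightarrow> J \<union> K) \<in> indep_sets V"
    proof -
      have "\<not> E b a" "\<not> E a b" if "a \<in> J" "b \<in> K" for a b
        using JK that E_sym[of a b] by (auto simp: indep_sets_def free_def)
      then show ?thesis using JK assms(2) by (auto simp: indep_sets_def free_def)
    qed
    show "f ((case a of (J,K) \<Rightarrow> J \<union> K) - U) ((case a of (J,K) \<Rightarrow> J \<union> K) \<inter> U) = (case a of (J,K) \<Rightarrow> f J K)"
      using * JK by simp
  qed auto
  finally show ?thesis by simp
qed

lemma power_card_split:
  fixes \<mu> :: real
  assumes "finite V" "A \<in> indep_sets V"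
  shows "\<mu> ^ card A = \<mu> ^ card (A - U) * \<mu> ^ card (A \<inter> U)"
proof -
  have "card A = card (A - U) + card (A \<inter> U)"
    using card_Int_Diff[OF indep_sets_finite[OF assms], of U] by simp
  then show ?thesis by (simp only: power_add)
qed

lemma Z_split:
  assumes "finite V" "U \<subseteq> V"
  shows "Z V \<mu> = (\<Sum>J\<in>indep_sets (V - U). \<mu> ^ card J * Z (free U J) \<mu>)"
proof -
  have "Z V \<mu> = (\<Sum>A\<in>indep_sets V. \<mu> ^ card (A - U) * \<mu> ^ card (A \<inter> U))"
    unfolding Z_def using power_card_split[OF assms(1)] by (intro sum.cong refl)
  also have "\<dots> = (\<Sum>J\<in>indep_sets (V - U). \<Sum>K\<in>indep_sets (free U J). \<mu> ^ card J * \<mu> ^ card K)"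
    by (rule sum_indep_split[OF assms, of "\<lambda>J K. \<mu> ^ card J * \<mu> ^ card K"])
  finally show ?thesis by (simp add: Z_def sum_distrib_left)
qed

lemma local_count_split:
  assumes "finite V" "U \<subseteq> V"
  shows "(\<Sum>A\<in>indep_sets V. real (card (A \<inter> U)) * \<mu> ^ card A)
       = (\<Sum>J\<in>indep_sets (V - U). \<mu> ^ card J * M (free U J) \<mu>)"
proof -
  have "(\<Sum>A\<in>indep_sets V. real (card (A \<inter> U)) * \<mu> ^ card A)
      = (\<Sum>A\<in>indep_sets V. \<mu> ^ card (A - U) * (real (card (A \<inter> U)) * \<mu> ^ card (A \<inter> U)))"
    by (intro sum.cong refl) (simp add: power_card_split[OF assms(1), where U = U])
  also have "\<dots> = (\<Sum>J\<in>indep_sets (V - U). \<Sum>K\<in>indep_sets (free U J). \<mu> ^ card J * (real (card K) * \<mu> ^ card K))"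
    by (rule sum_indep_split[OF assms, of "\<lambda>J K. \<mu> ^ card J * (real (card K) * \<mu> ^ card K)"])
  finally show ?thesis by (simp add: M_def sum_distrib_left)
qed

text \<open>Double counting: by symmetry of \<open>E\<close>, each member of \<open>A\<close> lies
  in the neighbourhoods of at most \<open>\<Delta>\<close> vertices.\<close>

lemma sum_local_count_le:
  assumes "finite V" "0 \<le> \<mu>" "\<And>v. v \<in> V \<Longrightarrow> real (card (V \<inter> {x. E v x})) \<le> \<Delta>"
  shows "(\<Sum>v\<in>V. \<Sum>A\<in>indep_sets V. real (card (A \<inter> (V \<inter> {x. E v x}))) * \<mu> ^ card A) \<le> \<Delta> * M V \<mu>"
proof -
  have "(\<Sum>v\<in>V. real (card (A \<inter> (V \<inter> {x. E v x})))) \<le> \<Delta> * real (card A)" if A: "A \<in> indep_sets V" for A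
  proof -
    have AV: "A \<subseteq> V" and fA: "finite A" using A assms by (auto simp: indep_sets_def intro: finite_subset)
    have "(\<Sum>v\<in>V. real (card (A \<inter> (V \<inter> {x. E v x})))) = (\<Sum>v\<in>V. \<Sum>a\<in>A. if E v a then 1 else 0)"
    proof (rule sum.cong[OF refl])
      fix v
      have "A \<inter> (V \<inter> {x. E v x}) = {a\<in>A. E v a}" using AV by auto
      then show "real (card (A \<inter> (V \<inter> {x. E v x}))) = (\<Sum>a\<in>A. if E v a then 1 else 0)"
        using fA by (simp add: sum.inter_filter[symmetric])
    qed
    also have "\<dots> = (\<Sum>a\<in>A. real (card (V \<inter> {x. E a x})))"
    proof (subst sum.swap, rule sum.cong[OF refl])
      fix a
      have "V \<inter> {x. E a x} = {v\<in>V. E v a}" using E_sym by auto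
      then show "(\<Sum>v\<in>V. if E v a then 1 else 0) = real (card (V \<inter> {x. E a x}))"
        using assms by (simp add: sum.inter_filter[symmetric])
    qed
    also have "\<dots> \<le> (\<Sum>a\<in>A. \<Delta>)" using assms AV by (intro sum_mono) auto
    finally show ?thesis by (simp add: mult.commute)
  qed
  then have "(\<Sum>A\<in>indep_sets V. (\<Sum>v\<in>V. real (card (A \<inter> (V \<inter> {x. E v x})))) * \<mu> ^ card A)
      \<le> (\<Sum>A\<in>indep_sets V. \<Delta> * real (card A) * \<mu> ^ card A)"
    using assms by (intro sum_mono mult_right_mono) auto
  then show ?thesis
    by (subst sum.swap) (simp add: M_def sum_distrib_left sum_distrib_right mult.assoc)
qed

text \<open>Condition on the independent set outside the neighbourhood of \<open>v\<close>, and let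
  \<open>X\<close> be the weighted total of \<open>\<mu>\<close> times the size of the free part of
  that neighbourhood. Counting occupied neighbours bounds \<open>M\<close> below by an increasing
  function of \<open>X\<close>, counting available vertices by a decreasing one. Eliminating
  \<open>X\<close> leaves a bound in terms of \<open>w\<close>, any subsolution of
  \<open>w * exp w = \<mu> * \<Delta>\<close>.\<close>

lemma M_ge:
  assumes V: "finite V" and mu: "0 < \<mu>" and D: "0 < \<Delta>"
    and deg: "\<And>v. v \<in> V \<Longrightarrow> real (card (V \<inter> {x. E v x})) \<le> \<Delta>"
    and sparse: "\<And>v T. v \<in> V \<Longrightarrow> T \<subseteq> V \<inter> {x. E v x} \<Longrightarrow>
        real (\<Sum>u\<in>T. card (T \<inter> {x. E u x})) \<le> D * real (card T)"
    and th: "\<theta> \<le> 1 - \<mu> * D" "0 < \<theta>" "\<theta> \<le> 1"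
    and w: "0 \<le> w" "w * exp w \<le> \<mu> * \<Delta>"
  shows "\<theta> * w * (real (card V) * Z V \<mu>) \<le> \<Delta> * M V \<mu>"
proof -
  define U where "U v = V \<inter> {x. E v x}" for v
  define X where "X = (\<Sum>v\<in>V. \<Sum>J\<in>indep_sets (V - U v). \<mu> ^ card J * (\<mu> * real (card (free (U v) J)) * Z (free (U v) J) \<mu>))"
  have UV: "U v \<subseteq> V" for v by (auto simp: U_def)
  have finT: "finite (free (U v) J)" for v J
    using V by (auto simp: free_def U_def intro: finite_subset)
  have Z1: "1 \<le> Z V \<mu>" using Z_ge_1 V mu by simp
  \<comment> \<open>Occupied neighbours: \<open>M_ge_sparse\<close> on every free set, then double
    counting.\<close>
  have "\<theta> * X = (\<Sum>v\<in>V. \<Sum>J\<in>indep_sets (V - U v). \<mu> ^ card J * (\<theta> * (\<mu> * real (card (free (U v) J))) * Z (free (U v) J) \<mu>))"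
    unfolding X_def by (simp add: sum_distrib_left algebra_simps)
  also have "\<dots> \<le> (\<Sum>v\<in>V. \<Sum>J\<in>indep_sets (V - U v). \<mu> ^ card J * M (free (U v) J) \<mu>)"
    using mu th finT
    by (intro sum_mono mult_left_mono M_ge_sparse[where D = D] sparse) (auto simp: U_def free_def)
  also have "\<dots> \<le> \<Delta> * M V \<mu>"
    using sum_local_count_le[OF V, of \<mu> \<Delta>] mu deg
    by (simp add: local_count_split[OF V UV, symmetric]) (simp add: U_def)
  finally have 1: "\<theta> * X \<le> \<Delta> * M V \<mu>" .
  \<comment> \<open>Available vertices: by \<open>M_eq\<close>, \<open>M\<close> is
    \<open>\<mu>\<close> times the weight of the independent sets avoiding the neighbourhood of
    \<open>v\<close>, summed over \<open>v\<close>.\<close>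
  have "\<mu> * exp (-w) * ((1 + w) * (real (card V) * Z V \<mu>) - X)
      = \<mu> * (\<Sum>v\<in>V. \<Sum>J\<in>indep_sets (V - U v). \<mu> ^ card J *
          (exp (-w) * (1 + w - \<mu> * real (card (free (U v) J))) * Z (free (U v) J) \<mu>))"
  proof -
    have "(1 + w) * (real (card V) * Z V \<mu>) = (\<Sum>v\<in>V. (1 + w) * Z V \<mu>)" by simp
    also have "\<dots> = (\<Sum>v\<in>V. (1 + w) * (\<Sum>J\<in>indep_sets (V - U v). \<mu> ^ card J * Z (free (U v) J) \<mu>))"
      using Z_split[OF V UV] by simp
    finally show ?thesis unfolding X_def
      by (simp add: sum_distrib_left sum_subtractf[symmetric] algebra_simps)
  qed
  also have "\<dots> \<le> \<mu> * (\<Sum>v\<in>V. \<Sum>J\<in>indep_sets (V - U v). \<mu> ^ card J * 1)"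
  proof (intro mult_left_mono sum_mono)
    fix v J
    let ?T = "free (U v) J" let ?x = "\<mu> * real (card ?T)"
    \<comment> \<open>The tangent of \<open>exp (- x)\<close> at \<open>w\<close> is linear in the size of the free set, so both estimates
      can be combined without Jensen's inequality.\<close>
    have "exp (-w) * (1 + w - ?x) \<le> exp (-w) * exp (w - ?x)"
      using exp_ge_add_one_self[of "w - ?x"] by (intro mult_left_mono) (auto simp: algebra_simps)
    also have "\<dots> = exp (- ?x)" by (simp add: exp_add[symmetric])
    finally have "exp (-w) * (1 + w - ?x) * Z ?T \<mu> \<le> exp (- ?x) * Z ?T \<mu>"
      using order_trans[OF zero_le_one Z_ge_1[OF finT less_imp_le[OF mu]]] by (intro mult_right_mono) auto
    also have "\<dots> \<le> exp (- ?x) * exp ?x"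
      using Z_le_exp[OF finT, of \<mu>] mu by (intro mult_left_mono) auto
    finally show "exp (-w) * (1 + w - ?x) * Z ?T \<mu> \<le> 1" by (simp add: exp_minus)
  qed (use mu in auto)
  also have "\<dots> = \<mu> * (\<Sum>v\<in>V. Z (V - U v) \<mu>)" by (simp add: Z_def)
  also have "\<dots> = M V \<mu>"
    unfolding M_eq[OF V] by (auto simp: U_def intro!: arg_cong[where f = "\<lambda>S. Z S \<mu>"] sum.cong)
  finally have 2: "\<mu> * exp (-w) * ((1 + w) * (real (card V) * Z V \<mu>) - X) \<le> M V \<mu>" .
  define y where "y = \<mu> * \<Delta> * exp (-w)"
  define P where "P = real (card V) * Z V \<mu>"
  have y: "w \<le> y" "0 < y" using w mu D by (auto simp: y_def exp_minus field_simps)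
  have P0: "0 \<le> P" using Z1 by (simp add: P_def)
  have "\<Delta> * (\<mu> * exp (-w) * ((1 + w) * P - X)) \<le> \<Delta> * M V \<mu>"
    using 2 D by (intro mult_left_mono) (auto simp: P_def)
  then have 3: "y * ((1 + w) * P - X) \<le> \<Delta> * M V \<mu>" by (simp add: y_def mult_ac)
  \<comment> \<open>The weights \<open>y\<close> and \<open>\<theta>\<close> make the terms in
    \<open>X\<close> cancel.\<close>
  have "y * (\<theta> * X) \<le> y * (\<Delta> * M V \<mu>)" using 1 y by (intro mult_left_mono) auto
  moreover have "\<theta> * (y * ((1 + w) * P - X)) \<le> \<theta> * (\<Delta> * M V \<mu>)"
    using 3 th by (intro mult_left_mono) auto
  ultimately have 4: "\<theta> * y * (1 + w) * P \<le> (\<theta> + y) * (\<Delta> * M V \<mu>)"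
    by (simp add: algebra_simps)
  \<comment> \<open>This amounts to \<open>\<theta> * w \<le> y\<close>, which follows from
    \<open>\<theta> \<le> 1\<close> and \<open>w \<le> y\<close>.\<close>
  have "(\<theta> + y) * w \<le> y * (1 + w)"
    using mult_right_mono[of \<theta> 1 w] th w y by (simp add: algebra_simps)
  then have "(\<theta> + y) * w * (\<theta> * P) \<le> y * (1 + w) * (\<theta> * P)"
    using th P0 by (intro mult_right_mono) auto
  with 4 have "(\<theta> + y) * (\<theta> * w * P) \<le> (\<theta> + y) * (\<Delta> * M V \<mu>)"
    by (simp add: mult_ac)
  then show ?thesis using th y by (simp add: P_def)
qed

section \<open>Integration over the logarithm of the fugacity\<close>

lemma Z_has_derivative:
  assumes "0 < \<Delta>"
  shows "((\<lambda>u. Z V (exp u / \<Delta>)) has_real_derivative M V (exp u / \<Delta>)) (at u)"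
proof -
  have "((\<lambda>u. (exp u / \<Delta>) ^ k) has_real_derivative real k * (exp u / \<Delta>) ^ k) (at u)" for k
    using DERIV_power[OF DERIV_cdivide[OF DERIV_exp[of u], of \<Delta>], of k] by (cases k) (simp_all add: mult_ac)
  then show ?thesis unfolding Z_def M_def by (intro DERIV_sum) auto
qed

text \<open>In the variable \<open>u = ln (\<mu> * \<Delta>)\<close> the derivative of
  \<open>ln Z\<close> is the expected size \<open>M / Z\<close>, which \<open>M_ge\<close> bounds
  below for \<open>0 \<le> u \<le> L\<close>. Instead of integrating, the proof shows that the
  difference \<open>F\<close> of the two sides is nondecreasing; it starts nonnegative because
  \<open>Z\<close> is at least 1.\<close>

lemma ln_Z_ge:
  assumes V: "finite V" and D: "0 < \<Delta>" and L: "0 \<le> L"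
    and deg: "\<And>v. v \<in> V \<Longrightarrow> real (card (V \<inter> {x. E v x})) \<le> \<Delta>"
    and sparse: "\<And>v T. v \<in> V \<Longrightarrow> T \<subseteq> V \<inter> {x. E v x} \<Longrightarrow>
        real (\<Sum>u\<in>T. card (T \<inter> {x. E u x})) \<le> D * real (card T)"
    and th: "\<theta> \<le> 1 - exp L / \<Delta> * D" "0 < \<theta>" "\<theta> \<le> 1" and "0 \<le> D"
  shows "real (card V) / \<Delta> * \<theta> * (L\<^sup>2 / 2 - L * ln (1 + L)) \<le> ln (Z V (exp L / \<Delta>))"
proof -
  define C where "C = real (card V) / \<Delta> * \<theta>"
  define F where "F u = ln (Z V (exp u / \<Delta>)) - C * (u\<^sup>2 / 2 - u * ln (1 + L))" for u
  have C0: "0 \<le> C" using D th by (simp add: C_def)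
  have Zp: "1 \<le> Z V (exp u / \<Delta>)" for u using Z_ge_1 V D by simp
  have "F 0 \<le> F L"
  proof (rule DERIV_nonneg_imp_nondecreasing[OF L])
    fix u assume u: "0 \<le> u" "u \<le> L"
    let ?\<mu> = "exp u / \<Delta>"
    \<comment> \<open>An explicit approximate solution of \<open>w * exp w = exp u\<close>, from below.\<close>
    define w where "w = u - ln (1 + u)"
    have w0: "0 \<le> w" using ln_add_one_self_le_self[of u] u by (simp add: w_def)
    have "w * exp w = exp u * (w / (1 + u))" using u by (simp add: w_def exp_diff)
    also have "\<dots> \<le> exp u * 1"
      using u by (intro mult_left_mono) (auto simp: w_def divide_le_eq intro: order_trans[of _ 0])
    finally have w1: "w * exp w \<le> ?\<mu> * \<Delta>" using D by simp
    have "\<theta> \<le> 1 - ?\<mu> * D"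
      using th(1) mult_right_mono[of ?\<mu> "exp L / \<Delta>" D] u D \<open>0 \<le> D\<close> by (auto simp: divide_right_mono)
    from M_ge[OF V _ D deg sparse this th(2,3) w0 w1] D
    have "\<theta> * w * (real (card V) * Z V ?\<mu>) \<le> \<Delta> * M V ?\<mu>" by simp
    then have "C * w \<le> M V ?\<mu> / Z V ?\<mu>"
      using D Zp[of u] by (simp add: C_def field_simps)
    \<comment> \<open>The constant \<open>ln (1 + L)\<close> in place of \<open>ln (1 + u)\<close>
      makes the lower bound linear in \<open>u\<close>, so the antiderivative used in
      \<open>F\<close> is elementary.\<close>
    moreover have "u - ln (1 + L) \<le> w" using u by (simp add: w_def)
    ultimately have "0 \<le> M V ?\<mu> / Z V ?\<mu> - C * (u - ln (1 + L))"
      using mult_left_mono[of "u - ln (1 + L)" w C] C0 by linarith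
    moreover have "(F has_real_derivative M V ?\<mu> / Z V ?\<mu> - C * (u - ln (1 + L))) (at u)"
      unfolding F_def using Zp[of u]
      by (auto intro!: derivative_eq_intros Z_has_derivative[OF D])
    ultimately show "\<exists>y. (F has_real_derivative y) (at u) \<and> 0 \<le> y" by blast
  qed
  moreover have "0 \<le> F 0" using Zp[of 0] by (simp add: F_def)
  ultimately show ?thesis by (simp add: F_def C_def)
qed

end

section \<open>The block norm and its uniform convexity\<close>

text \<open>The \<open>p\<close>-th power of the block norm. It is additive over the blocks, so
  inequalities can be proved block by block.\<close>

definition bsum :: "real \<Rightarrow> nat \<Rightarrow> (nat \<Rightarrow> nat) \<Rightarrow> (nat \<Rightarrow> real) \<Rightarrow> real" where
  "bsum p m k x = (\<Sum>j<m. L2_set x {k j..<k (Suc j)} powr p)"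

lemma blocknorm_bsum: "blocknorm p m k x = bsum p m k x powr (1 / p)"
  by (simp add: blocknorm_def bsum_def L2_set_def)

lemma bsum_nonneg: "0 \<le> bsum p m k x"
  unfolding bsum_def by (intro sum_nonneg) auto

lemma blocknorm_nonneg: "0 \<le> blocknorm p m k x"
  by (simp add: blocknorm_bsum)

lemma bsum_blocknorm: "0 < p \<Longrightarrow> bsum p m k x = blocknorm p m k x powr p"
  by (simp add: blocknorm_bsum powr_powr bsum_nonneg)

lemma blocknorm_le_iff:
  assumes "0 < p" "0 \<le> r"
  shows "blocknorm p m k x \<le> r \<longleftrightarrow> bsum p m k x \<le> r powr p"
  unfolding bsum_blocknorm[OF assms(1)] using assms blocknorm_nonneg powr_mono2 powr_less_mono2
  by (meson less_eq_real_def linorder_not_le)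

lemma bsum_scale:
  "bsum p m k (\<lambda>i. c * x i) = \<bar>c\<bar> powr p * bsum p m k x"
proof -
  have "L2_set (\<lambda>i. c * x i) A = \<bar>c\<bar> * L2_set x A" for A
    by (simp add: L2_set_def power_mult_distrib sum_distrib_left[symmetric] real_sqrt_mult)
  then show ?thesis by (simp add: bsum_def powr_mult sum_distrib_left)
qed

lemma blocknorm_scale:
  assumes "0 < p"
  shows "blocknorm p m k (\<lambda>i. c * x i) = \<bar>c\<bar> * blocknorm p m k x"
  using assms by (simp add: blocknorm_bsum bsum_scale powr_mult powr_powr)

lemma blocknorm_minus_commute:
  assumes "0 < p"
  shows "blocknorm p m k (\<lambda>i. x i - y i) = blocknorm p m k (\<lambda>i. y i - x i)"
  using blocknorm_scale[OF assms, of m k "-1" "\<lambda>i. y i - x i"] by simp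

section \<open>Convexity and the triangle inequality\<close>

lemma powr_convex_ge0:
  fixes p :: real assumes "1 \<le> p" "0 \<le> a" "0 \<le> x" "0 \<le> y" "a \<le> 1"
  shows "(a * x + (1 - a) * y) powr p \<le> a * x powr p + (1 - a) * y powr p"
\<comment> \<open>If \<open>x\<close> or \<open>y\<close> vanishes, the claim reduces to
  \<open>b powr p \<le> b\<close> for a weight \<open>b\<close> in the unit interval.\<close>
proof (cases "a = 0 \<or> a = 1 \<or> x = 0 \<or> y = 0")
  case False
  then show ?thesis
    using convex_onD[OF powr_convex[OF assms(1)], of "1 - a" x y] assms by simp
next
  case True
  have le: "b powr p \<le> b" if "0 \<le> b" "b \<le> 1" for b :: real
    using powr_mono'[of 1 p b] that assms by (cases "b = 0") auto
  show ?thesis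
    using True le[of a] le[of "1 - a"] assms
    by (auto simp: powr_mult intro!: mult_right_mono)
qed

lemma bsum_mono:
  assumes "0 \<le> p" and "k m \<le> n" and "\<And>j. j < m \<Longrightarrow> k j < k (Suc j)"
    and "\<And>i. i < n \<Longrightarrow> \<bar>x i\<bar> \<le> \<bar>y i\<bar>"
  shows "bsum p m k x \<le> bsum p m k y"
proof -
  have kle: "k j \<le> k m" if "j \<le> m" for j
    using that assms(3) by (induction rule: inc_induct) (auto intro: less_imp_le order_trans)
  show ?thesis
    unfolding bsum_def L2_set_def
  proof (intro sum_mono powr_mono2 real_sqrt_le_mono)
    fix j i assume "j \<in> {..<m}" "i \<in> {k j..<k (Suc j)}"
    then have "i < n" using kle[of "Suc j"] assms(2) by simp
    then show "(x i)\<^sup>2 \<le> (y i)\<^sup>2" using assms(4) by (simp add: abs_le_square_iff)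
  qed (auto intro!: sum_nonneg assms)
qed

lemma bsum_coord_le:
  assumes "0 < p" and "valid_k n m k" and "i < n"
  shows "\<bar>x i\<bar> powr p \<le> bsum p m k x"
proof -
  have "\<exists>j<m. i \<in> {k j..<k (Suc j)}"
  proof -
    \<comment> \<open>The block containing \<open>i\<close> is the first whose right end exceeds
      \<open>i\<close>; minimality puts its left end at or below \<open>i\<close>.\<close>
    define j where "j = (LEAST j. i < k (Suc j))"
    have m0: "m \<noteq> 0" using assms by (auto simp: valid_k_def intro: gr0I)
    then have ex: "i < k (Suc (m - 1))" using assms by (simp add: valid_k_def)
    then have 1: "i < k (Suc j)" "j \<le> m - 1" unfolding j_def by (auto intro: LeastI Least_le)
    have "k j \<le> i"
    proof (cases j)
      case 0 then show ?thesis using assms by (simp add: valid_k_def)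
    next
      case (Suc j')
      then have "\<not> i < k (Suc j')" using not_less_Least[of j' "\<lambda>j. i < k (Suc j)"] by (simp add: j_def)
      then show ?thesis using Suc by simp
    qed
    then show ?thesis using 1 m0 by (intro exI[of _ j]) auto
  qed
  then obtain j where j: "j < m" "i \<in> {k j..<k (Suc j)}" by auto
  have "\<bar>x i\<bar> = L2_set x {i}" by (simp add: L2_set_def)
  also have "\<dots> \<le> L2_set x {k j..<k (Suc j)}"
    unfolding L2_set_def using j by (intro real_sqrt_le_mono sum_mono2) auto
  finally have "\<bar>x i\<bar> powr p \<le> L2_set x {k j..<k (Suc j)} powr p"
    using assms by (intro powr_mono2) auto
  also have "\<dots> \<le> bsum p m k x"
    unfolding bsum_def using j
    by (intro member_le_sum[of j "{..<m}" "\<lambda>j. L2_set x {k j..<k (Suc j)} powr p"]) auto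
  finally show ?thesis .
qed

lemma abs_coord_le_blocknorm:
  assumes "0 < p" and "valid_k n m k" and "i < n"
  shows "\<bar>x i\<bar> \<le> blocknorm p m k x"
  using bsum_coord_le[OF assms, of x] powr_less_mono2[OF assms(1) blocknorm_nonneg, of p m k x "\<bar>x i\<bar>"] assms(1)
  unfolding bsum_blocknorm[OF assms(1)] by linarith

lemma blocknorm_mono:
  assumes "0 < p" and "valid_k n m k" and "\<And>i. i < n \<Longrightarrow> \<bar>x i\<bar> \<le> \<bar>y i\<bar>"
  shows "blocknorm p m k x \<le> blocknorm p m k y"
  unfolding blocknorm_bsum using assms
  by (intro powr_mono2 bsum_mono[where n = n] bsum_nonneg) (auto simp: valid_k_def)

lemma blocknorm_cong:
  assumes "0 < p" and "valid_k n m k" and "\<And>i. i < n \<Longrightarrow> x i = y i"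
  shows "blocknorm p m k x = blocknorm p m k y"
  using assms by (intro antisym blocknorm_mono[OF assms(1,2)]) auto

text \<open>In each block, the Euclidean triangle inequality followed by convexity of the
  \<open>p\<close>-th power.\<close>

lemma bsum_convex:
  assumes "1 \<le> p" "0 \<le> a" "a \<le> 1"
  shows "bsum p m k (\<lambda>i. a * x i + (1 - a) * y i) \<le> a * bsum p m k x + (1 - a) * bsum p m k y"
proof -
  have scale: "L2_set (\<lambda>i. c * x i) A = c * L2_set x A" if "0 \<le> c" for c x and A :: "nat set"
    using that by (simp add: L2_set_def power_mult_distrib sum_distrib_left[symmetric] real_sqrt_mult)
  have "L2_set (\<lambda>i. a * x i + (1 - a) * y i) A powr p
      \<le> a * L2_set x A powr p + (1 - a) * L2_set y A powr p" for A
  proof -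
    have "L2_set (\<lambda>i. a * x i + (1 - a) * y i) A powr p \<le> (a * L2_set x A + (1 - a) * L2_set y A) powr p"
      using assms L2_set_triangle_ineq[of "\<lambda>i. a * x i" "\<lambda>i. (1 - a) * y i" A] scale[of a x] scale[of "1 - a" y]
      by (intro powr_mono2) auto
    also have "\<dots> \<le> a * L2_set x A powr p + (1 - a) * L2_set y A powr p"
      using assms by (intro powr_convex_ge0) auto
    finally show ?thesis .
  qed
  then show ?thesis
    unfolding bsum_def by (simp add: sum_distrib_left sum.distrib[symmetric] sum_mono)
qed

text \<open>Minkowski's inequality from convexity of \<open>bsum\<close>: \<open>x / s\<close> and
  \<open>y / t\<close> lie in the unit ball, and \<open>(x + y) / (s + t)\<close> is a convex
  combination of them.\<close>

lemma blocknorm_triangle: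
  assumes "1 \<le> p"
  shows "blocknorm p m k (\<lambda>i. x i + y i) \<le> blocknorm p m k x + blocknorm p m k y"
proof (rule field_le_epsilon)
  fix e :: real assume e: "0 < e"
  \<comment> \<open>The slack \<open>e / 2\<close> keeps \<open>s\<close> and \<open>t\<close>
    positive when a norm vanishes.\<close>
  define s where "s = blocknorm p m k x + e / 2"
  define t where "t = blocknorm p m k y + e / 2"
  have st: "0 < s" "0 < t" using e blocknorm_nonneg by (auto simp: s_def t_def add_nonneg_pos)
  define a where "a = s / (s + t)"
  have a: "0 \<le> a" "a \<le> 1" using st by (auto simp: a_def)
  have a1: "1 - a = t / (s + t)" using st by (simp add: a_def field_simps)
  have le1: "bsum p m k (\<lambda>i. 1 / s * x i) \<le> 1" "bsum p m k (\<lambda>i. 1 / t * y i) \<le> 1"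
    using blocknorm_le_iff[of p 1 m k "\<lambda>i. 1 / s * x i"] blocknorm_le_iff[of p 1 m k "\<lambda>i. 1 / t * y i"] assms st e
      blocknorm_scale[of p m k "1 / s" x] blocknorm_scale[of p m k "1 / t" y]
    by (auto simp: s_def t_def divide_le_eq)
  have "bsum p m k (\<lambda>i. a * (1 / s * x i) + (1 - a) * (1 / t * y i)) \<le> a * 1 + (1 - a) * 1"
    using a le1 by (intro order_trans[OF bsum_convex[OF assms a]] add_mono mult_left_mono) auto
  moreover have "(\<lambda>i. a * (1 / s * x i) + (1 - a) * (1 / t * y i)) = (\<lambda>i. 1 / (s + t) * (x i + y i))"
    unfolding a1 unfolding a_def using st by (simp add: fun_eq_iff add_divide_distrib)
  ultimately have "blocknorm p m k (\<lambda>i. 1 / (s + t) * (x i + y i)) \<le> 1"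
    using assms blocknorm_le_iff[of p 1 m k] by simp
  then have "blocknorm p m k (\<lambda>i. x i + y i) \<le> s + t"
    using assms st blocknorm_scale[of p m k "1 / (s + t)" "\<lambda>i. x i + y i"] by (simp add: divide_le_eq)
  then show "blocknorm p m k (\<lambda>i. x i + y i) \<le> blocknorm p m k x + blocknorm p m k y + e"
    by (simp add: s_def t_def)
qed

section \<open>Uniform convexity\<close>

lemma powr_midpoint_less:
  fixes B p :: real assumes "1 < p" "0 \<le> B" "B < 1"
  shows "((1 + B) / 2) powr p < (1 + B powr p) / 2"
proof -
  have tangent: "p * c powr (p - 1) * (x - c) < x powr p - c powr p" if c: "0 < c" "c < x" for x c :: real
  proof -
    have "\<exists>z. c < z \<and> z < x \<and> x powr p - c powr p = (x - c) * (p * z powr (p - 1))"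
      using c by (intro MVT2) (auto intro!: derivative_eq_intros simp: powr_diff)
    then obtain z where z: "c < z" "z < x" "x powr p - c powr p = (x - c) * (p * z powr (p - 1))" by blast
    have "c powr (p - 1) < z powr (p - 1)" using z c assms by (intro powr_less_mono2) auto
    then show ?thesis using z c assms by (simp add: mult_ac)
  qed
  have tangent': "p * c powr (p - 1) * (x - c) \<le> x powr p - c powr p" if c: "0 \<le> x" "x < c" for x c :: real
  proof (cases "x = 0")
    case True
    have "c * c powr (p - 1) = c powr p" using c powr_mult_base[of c "p - 1"] by simp
    moreover have "0 \<le> (p - 1) * c powr p" using assms by simp
    ultimately show ?thesis using True assms by (simp add: algebra_simps)
  next
    case False
    have "\<exists>z. x < z \<and> z < c \<and> c powr p - x powr p = (c - x) * (p * z powr (p - 1))"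
      using c False by (intro MVT2) (auto intro!: derivative_eq_intros simp: powr_diff)
    then obtain z where z: "x < z" "z < c" "c powr p - x powr p = (c - x) * (p * z powr (p - 1))" by blast
    have "z powr (p - 1) \<le> c powr (p - 1)" using z c assms by (intro powr_mono2) auto
    then have "(c - x) * (p * z powr (p - 1)) \<le> (c - x) * (p * c powr (p - 1))"
      using c assms by (intro mult_left_mono) auto
    then show ?thesis using z by (simp add: algebra_simps)
  qed
  \<comment> \<open>Tangent at the midpoint \<open>(1 + B) / 2\<close>: the two linear terms cancel,
    and strictness at the endpoint \<open>1\<close> suffices.\<close>
  show ?thesis
    using tangent[of "(1 + B) / 2" 1] tangent'[of B "(1 + B) / 2"] assms
    by (simp add: field_simps)
qed

text \<open>\<open>1\<close>, \<open>B\<close>, \<open>D\<close> and \<open>M\<close> stand for the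
  lengths of two vectors, their difference and their midpoint, tied by the parallelogram law and the
  triangle inequality. Only these lengths enter, so \<open>\<kappa>\<close> is free of the
  dimension. The gap is positive at every point of a compact set, hence bounded below.\<close>

lemma uniform_convexity_normalised:
  fixes p \<epsilon> :: real assumes p: "1 < p" and e: "0 < \<epsilon>"
  obtains \<kappa> where "0 < \<kappa>"
    "\<And>B D M. 0 \<le> B \<Longrightarrow> B \<le> 1 \<Longrightarrow> \<epsilon> \<le> D \<Longrightarrow> 1 - B \<le> D \<Longrightarrow> D \<le> 1 + B \<Longrightarrow> 0 \<le> M \<Longrightarrow>
       4 * M\<^sup>2 + D\<^sup>2 = 2 + 2 * B\<^sup>2 \<Longrightarrow> M powr p \<le> (1 + B powr p) / 2 - \<kappa>"
proof -
  define F where "F = (\<lambda>x::real\<times>real. (sqrt ((2 + 2 * (fst x)\<^sup>2 - (snd x)\<^sup>2) / 4)) powr p - (1 + fst x powr p) / 2)"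
  define K where "K = {x. 0 \<le> fst x \<and> fst x \<le> 1 \<and> \<epsilon> \<le> snd x \<and> 1 - fst x \<le> snd x \<and> snd x \<le> 1 + fst x}"
  \<comment> \<open>\<open>D2\<close> makes the radicand in \<open>F\<close> nonnegative;
    \<open>D1\<close> bounds the midpoint length by \<open>(1 + B) / 2\<close>.\<close>
  have D2: "(1 - B)\<^sup>2 \<le> 2 + 2 * B\<^sup>2 - D\<^sup>2" if "0 \<le> B" "\<epsilon> \<le> D" "D \<le> 1 + B" for B D :: real
  proof -
    have "D\<^sup>2 \<le> (1 + B)\<^sup>2" using that e by (intro power_mono) auto
    then show ?thesis by (simp add: power2_eq_square algebra_simps)
  qed
  have D1: "2 + 2 * B\<^sup>2 - D\<^sup>2 \<le> (1 + B)\<^sup>2" if "B \<le> 1" "1 - B \<le> D" for B D :: real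
  proof -
    have "(1 - B)\<^sup>2 \<le> D\<^sup>2" using that by (intro power_mono) auto
    then show ?thesis by (simp add: power2_eq_square algebra_simps)
  qed
  have Fneg: "F x < 0" if x: "x \<in> K" for x
  proof -
    obtain B D where BD: "x = (B, D)" by force
    have h: "0 \<le> B" "B \<le> 1" "\<epsilon> \<le> D" "1 - B \<le> D" "D \<le> 1 + B" using x BD by (auto simp: K_def)
    show ?thesis
    \<comment> \<open>For equal lengths strictness comes from \<open>\<epsilon> \<le> D\<close>,
      otherwise from strict convexity of the power.\<close>
    proof (cases "B = 1")
      case True
      have "0 < D\<^sup>2" using h e by simp
      then have "sqrt ((4 - D\<^sup>2) / 4) powr p < 1 powr p"
        using D2[of B D] h True p by (intro powr_less_mono2) auto
      then show ?thesis using True BD by (simp add: F_def)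
    next
      case False
      have "sqrt ((2 + 2 * B\<^sup>2 - D\<^sup>2) / 4) \<le> (1 + B) / 2"
        using D1[of B D] h by (intro real_le_lsqrt) (auto simp: power_divide)
      then have "sqrt ((2 + 2 * B\<^sup>2 - D\<^sup>2) / 4) powr p \<le> ((1 + B) / 2) powr p"
        using order_trans[OF zero_le_power2 D2[of B D]] h p by (intro powr_mono2) auto
      also have "\<dots> < (1 + B powr p) / 2" using h False p by (intro powr_midpoint_less) auto
      finally show ?thesis using BD by (simp add: F_def)
    qed
  qed
  have "compact K"
  proof (rule compact_eq_bounded_closed[THEN iffD2], rule conjI)
    have "K \<subseteq> {0..1} \<times> {\<epsilon>..2}" by (auto simp: K_def)
    then show "bounded K" by (rule bounded_subset[rotated]) (intro bounded_Times bounded_closed_interval)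
    show "closed K" unfolding K_def by (intro closed_Collect_conj closed_Collect_le continuous_intros)
  qed
  moreover have "continuous_on K F"
    unfolding F_def using p order_trans[OF zero_le_power2 D2]
    by (intro continuous_intros continuous_on_powr') (auto simp: K_def)
  ultimately have "\<exists>\<kappa>>0. \<forall>x\<in>K. F x \<le> - \<kappa>"
  proof (cases "K = {}")
    case True then show ?thesis by (intro exI[of _ 1]) auto
  next
    case False
    assume "compact K" "continuous_on K F"
    from continuous_attains_sup[OF this(1) False this(2)] obtain x where "x \<in> K" "\<forall>y\<in>K. F y \<le> F x" by auto
    then show ?thesis using Fneg by (intro exI[of _ "- F x"]) auto
  qed
  then obtain \<kappa> where k: "0 < \<kappa>" "\<And>x. x \<in> K \<Longrightarrow> F x \<le> - \<kappa>" by blast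
  show thesis
  proof (rule that[OF k(1)])
    fix B D M :: real assume h: "0 \<le> B" "B \<le> 1" "\<epsilon> \<le> D" "1 - B \<le> D" "D \<le> 1 + B" "0 \<le> M"
      "4 * M\<^sup>2 + D\<^sup>2 = 2 + 2 * B\<^sup>2"
    have "(2 + 2 * B\<^sup>2 - D\<^sup>2) / 4 = M\<^sup>2" using h(7) by simp
    then have "sqrt ((2 + 2 * B\<^sup>2 - D\<^sup>2) / 4) = M" using h(6) by simp
    then show "M powr p \<le> (1 + B powr p) / 2 - \<kappa>"
      using k(2)[of "(B, D)"] h by (simp add: K_def F_def)
  qed
qed

text \<open>A homogeneous form, linear in the \<open>p\<close>-th powers, so that it can be summed
  over blocks. If \<open>D\<close> is small relative to the longer vector, the correction with
  \<open>\<epsilon> powr p\<close> makes the gain nonpositive and convexity suffices; otherwise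
  rescale by the longer vector.\<close>

lemma uniform_convexity_pointwise:
  fixes p \<epsilon> :: real assumes p: "1 < p" and e: "0 < \<epsilon>"
  obtains \<kappa> where "0 < \<kappa>"
    "\<And>A B D M. 0 \<le> A \<Longrightarrow> 0 \<le> B \<Longrightarrow> 0 \<le> D \<Longrightarrow> \<bar>A - B\<bar> \<le> D \<Longrightarrow> D \<le> A + B \<Longrightarrow> 0 \<le> M \<Longrightarrow>
       4 * M\<^sup>2 + D\<^sup>2 = 2 * A\<^sup>2 + 2 * B\<^sup>2 \<Longrightarrow>
       M powr p \<le> (A powr p + B powr p) / 2 - \<kappa> * (D powr p - \<epsilon> powr p * (A powr p + B powr p))"
proof -
  obtain \<kappa>0 where k0: "0 < \<kappa>0" and k1:
    "\<And>B D M. 0 \<le> B \<Longrightarrow> B \<le> 1 \<Longrightarrow> \<epsilon> \<le> D \<Longrightarrow> 1 - B \<le> D \<Longrightarrow> D \<le> 1 + B \<Longrightarrow> 0 \<le> M \<Longrightarrow>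
       4 * M\<^sup>2 + D\<^sup>2 = 2 + 2 * B\<^sup>2 \<Longrightarrow> M powr p \<le> (1 + B powr p) / 2 - \<kappa>0"
    using uniform_convexity_normalised[OF p e] by blast
  \<comment> \<open>Dividing by \<open>2 powr p\<close> compensates for
    \<open>D \<le> 2 * A\<close>.\<close>
  define \<kappa> where "\<kappa> = \<kappa>0 / 2 powr p"
  have kp: "0 < \<kappa>" using k0 by (simp add: \<kappa>_def)
  have main: "M powr p \<le> (A powr p + B powr p) / 2 - \<kappa> * (D powr p - \<epsilon> powr p * (A powr p + B powr p))"
    if h: "0 \<le> A" "0 \<le> B" "0 \<le> D" "\<bar>A - B\<bar> \<le> D" "D \<le> A + B" "0 \<le> M" "B \<le> A"
      "4 * M\<^sup>2 + D\<^sup>2 = 2 * A\<^sup>2 + 2 * B\<^sup>2" for A B D M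
  proof (cases "\<epsilon> * A \<le> D \<and> A \<noteq> 0")
    case True
    then have A: "0 < A" using h by simp
    have "4 * (M / A)\<^sup>2 + (D / A)\<^sup>2 = 2 + 2 * (B / A)\<^sup>2"
      using h(8) A by (simp add: power_divide field_simps)
    moreover have "1 - B / A \<le> D / A" "D / A \<le> 1 + B / A" "B / A \<le> 1" "\<epsilon> \<le> D / A"
      using h A True divide_right_mono[of "A - B" D A] divide_right_mono[of D "A + B" A]
      by (simp_all add: diff_divide_distrib add_divide_distrib pos_le_divide_eq)
    ultimately have "(M / A) powr p \<le> (1 + (B / A) powr p) / 2 - \<kappa>0"
      using k1[of "B / A" "D / A" "M / A"] h A by simp
    then have "M powr p \<le> (A powr p + B powr p) / 2 - \<kappa>0 * A powr p"
      using A h by (simp add: powr_divide field_simps)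
    moreover have "\<kappa> * D powr p \<le> \<kappa>0 * A powr p"
    proof -
      have "D powr p \<le> (2 * A) powr p" using h p by (intro powr_mono2) auto
      then have "\<kappa> * D powr p \<le> \<kappa> * (2 powr p * A powr p)"
        using kp A by (intro mult_left_mono) (auto simp: powr_mult)
      then show ?thesis by (simp add: \<kappa>_def)
    qed
    moreover have "0 \<le> \<kappa> * (\<epsilon> powr p * (A powr p + B powr p))" using kp by simp
    ultimately show ?thesis unfolding right_diff_distrib by linarith
  next
    case False
    have DA: "D \<le> \<epsilon> * A" using False h e by auto
    then have "D powr p \<le> \<epsilon> powr p * A powr p"
      using h p e by (metis powr_mono2 powr_mult less_imp_le order_less_trans zero_less_one)
    also have "\<dots> \<le> \<epsilon> powr p * (A powr p + B powr p)" by (intro mult_left_mono) auto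
    finally have 1: "\<kappa> * (D powr p - \<epsilon> powr p * (A powr p + B powr p)) \<le> 0"
      using kp by (simp add: mult_le_0_iff)
    have "(A - B)\<^sup>2 \<le> D\<^sup>2" using h by (metis abs_le_square_iff abs_of_nonneg)
    then have "M\<^sup>2 \<le> ((A + B) / 2)\<^sup>2" using h(8) by (simp add: power2_eq_square algebra_simps)
    then have "M \<le> (A + B) / 2" using h by (intro power2_le_imp_le[of M]) auto
    then have "M powr p \<le> ((A + B) / 2) powr p" using h p by (intro powr_mono2) auto
    also have "\<dots> \<le> (A powr p + B powr p) / 2"
      using powr_convex_ge0[of p "1/2" A B] h p by (simp add: add_divide_distrib)
    finally show ?thesis using 1 by linarith
  qed
  show thesis
  proof (rule that[OF kp])
    fix A B D M :: real
    assume h: "0 \<le> A" "0 \<le> B" "0 \<le> D" "\<bar>A - B\<bar> \<le> D" "D \<le> A + B" "0 \<le> M"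
      "4 * M\<^sup>2 + D\<^sup>2 = 2 * A\<^sup>2 + 2 * B\<^sup>2"
    show "M powr p \<le> (A powr p + B powr p) / 2 - \<kappa> * (D powr p - \<epsilon> powr p * (A powr p + B powr p))"
      using main[of A B D M] main[of B A D M] h by (cases "B \<le> A") (auto simp: add.commute abs_minus_commute)
  qed
qed

text \<open>Summing the pointwise estimate over the blocks gives a constant independent of their
  number and sizes. A separation of at least half the radius then shrinks the norm of the midpoint
  by a fixed factor.\<close>

lemma uniform_convexity_blocknorm:
  fixes p :: real assumes p: "1 < p"
  obtains \<beta> where "1 / 2 \<le> \<beta>" "\<beta> < 1"
    "\<And>m k x y \<rho>. 0 \<le> \<rho> \<Longrightarrow> blocknorm p m k x \<le> \<rho> \<Longrightarrow> blocknorm p m k y \<le> \<rho> \<Longrightarrow>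
      \<rho> / 2 \<le> blocknorm p m k (\<lambda>i. x i - y i) \<Longrightarrow>
      blocknorm p m k (\<lambda>i. (x i + y i) / 2) \<le> \<beta> * \<rho>"
proof -
  \<comment> \<open>Small enough for \<open>\<tau>\<close> to be positive: the loss
    \<open>2 * \<epsilon> powr p\<close> stays below the gain \<open>(1 / 2) powr p\<close> because
    \<open>2 < 4 powr p\<close>.\<close>
  define \<epsilon> :: real where "\<epsilon> = 1 / 8"
  obtain \<kappa> where k0: "0 < \<kappa>" and k1:
    "\<And>A B D M. 0 \<le> A \<Longrightarrow> 0 \<le> B \<Longrightarrow> 0 \<le> D \<Longrightarrow> \<bar>A - B\<bar> \<le> D \<Longrightarrow> D \<le> A + B \<Longrightarrow> 0 \<le> M \<Longrightarrow>
       4 * M\<^sup>2 + D\<^sup>2 = 2 * A\<^sup>2 + 2 * B\<^sup>2 \<Longrightarrow>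
       M powr p \<le> (A powr p + B powr p) / 2 - \<kappa> * (D powr p - \<epsilon> powr p * (A powr p + B powr p))"
    using uniform_convexity_pointwise[OF p, of \<epsilon>] by (auto simp: \<epsilon>_def)
  define \<tau> where "\<tau> = (1 / 2) powr p - 2 * \<epsilon> powr p"
  have tau: "0 < \<tau>"
  proof -
    have "2 * \<epsilon> powr p < 4 powr p * \<epsilon> powr p"
      using powr_less_mono[of 1 p 4] p by (intro mult_strict_right_mono) (auto simp: \<epsilon>_def)
    also have "\<dots> = (1 / 2) powr p" by (simp add: powr_mult[symmetric] \<epsilon>_def)
    finally show ?thesis by (simp add: \<tau>_def)
  qed
  \<comment> \<open>The maximum forces the final factor to be at least \<open>1 / 2\<close>, on
    which the neighbourhood counting relies.\<close>
  define b where "b = max ((1 / 2) powr p) (1 - \<kappa> * \<tau>)"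
  have b: "0 < b" "b < 1" "(1 / 2) powr p \<le> b" using k0 tau p powr_less_mono2[of p "1/2" 1] by (auto simp: b_def less_max_iff_disj)
  have bs: "bsum p m k (\<lambda>i. (x i + y i) / 2)
     \<le> (bsum p m k x + bsum p m k y) / 2 - \<kappa> * (bsum p m k (\<lambda>i. x i - y i) - \<epsilon> powr p * (bsum p m k x + bsum p m k y))"
    for m k x y
  proof -
    have "L2_set (\<lambda>i. (x i + y i) / 2) J powr p
       \<le> (L2_set x J powr p + L2_set y J powr p) / 2
         - \<kappa> * (L2_set (\<lambda>i. x i - y i) J powr p - \<epsilon> powr p * (L2_set x J powr p + L2_set y J powr p))" for J
    proof (rule k1)
      have tri: "L2_set (\<lambda>i. u i - v i) J \<le> L2_set u J + L2_set v J" for u v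
        using L2_set_triangle_ineq[of u "\<lambda>i. - v i" J] by (simp add: L2_set_def)
      have tri': "L2_set u J \<le> L2_set (\<lambda>i. u i - v i) J + L2_set v J" for u v
        using L2_set_triangle_ineq[of "\<lambda>i. u i - v i" v J] by simp
      have comm: "L2_set (\<lambda>i. y i - x i) J = L2_set (\<lambda>i. x i - y i) J"
        by (simp add: L2_set_def power2_commute)
      show "\<bar>L2_set x J - L2_set y J\<bar> \<le> L2_set (\<lambda>i. x i - y i) J"
        using tri'[of x y] tri'[of y x] comm by linarith
      show "L2_set (\<lambda>i. x i - y i) J \<le> L2_set x J + L2_set y J" by (rule tri)
      have sq: "(L2_set u J)\<^sup>2 = (\<Sum>i\<in>J. (u i)\<^sup>2)" for u by (simp add: L2_set_def sum_nonneg)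
      show "4 * (L2_set (\<lambda>i. (x i + y i) / 2) J)\<^sup>2 + (L2_set (\<lambda>i. x i - y i) J)\<^sup>2
          = 2 * (L2_set x J)\<^sup>2 + 2 * (L2_set y J)\<^sup>2"
        unfolding sq sum_distrib_left sum.distrib[symmetric]
        by (intro sum.cong refl) (simp add: power2_eq_square field_simps)
    qed auto
    then show ?thesis
      unfolding bsum_def sum_distrib_left sum_divide_distrib sum.distrib[symmetric] sum_subtractf[symmetric]
      by (intro sum_mono) auto
  qed
  show thesis
  proof (rule that[of "b powr (1 / p)"])
    show "1 / 2 \<le> b powr (1 / p)"
      using powr_mono2[OF _ _ b(3), of "1 / p"] p by (simp add: powr_powr)
    show "b powr (1 / p) < 1" using powr_less_mono2[of "1/p" b 1] b p by simp
    fix m k \<rho> and x y :: "nat \<Rightarrow> real"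
    assume h: "0 \<le> \<rho>" "blocknorm p m k x \<le> \<rho>" "blocknorm p m k y \<le> \<rho>"
      "\<rho> / 2 \<le> blocknorm p m k (\<lambda>i. x i - y i)"
    let ?P = "\<rho> powr p"
    have x: "bsum p m k x \<le> ?P" and y: "bsum p m k y \<le> ?P"
      using h p blocknorm_le_iff[of p \<rho>] by auto
    have d: "(1 / 2) powr p * ?P \<le> bsum p m k (\<lambda>i. x i - y i)"
      unfolding bsum_blocknorm[OF order.strict_trans[OF zero_less_one p]] powr_mult[symmetric]
      using h p by (intro powr_mono2) auto
    have "bsum p m k (\<lambda>i. (x i + y i) / 2) \<le> (?P + ?P) / 2 - \<kappa> * ((1 / 2) powr p * ?P - \<epsilon> powr p * (?P + ?P))"
      using x y d k0 by (intro order_trans[OF bs] diff_mono divide_right_mono add_mono mult_left_mono) auto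
    also have "\<dots> = (1 - \<kappa> * \<tau>) * ?P" by (simp add: \<tau>_def algebra_simps)
    also have "\<dots> \<le> b * ?P" by (intro mult_right_mono) (auto simp: b_def)
    also have "\<dots> = (b powr (1 / p) * \<rho>) powr p" using b p by (simp add: powr_mult powr_powr)
    finally show "blocknorm p m k (\<lambda>i. (x i + y i) / 2) \<le> b powr (1 / p) * \<rho>"
      using blocknorm_le_iff[of p "b powr (1 / p) * \<rho>"] h p by simp
  qed
qed

section \<open>Volumes and the grid\<close>

interpretation lborel_prod: product_sigma_finite "\<lambda>_::nat. lborel :: real measure" ..

lemma space_lebn: "space (lebn n) = extensional {..<n}"
  by (auto simp: lebn_def space_PiM PiE_def)

lemma emeasure_lebn_box:
  assumes "\<And>i. i < n \<Longrightarrow> A i \<in> sets borel"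
  shows "emeasure (lebn n) (PiE {..<n} A) = (\<Prod>i<n. emeasure lborel (A i))"
  unfolding lebn_def using assms by (subst lborel_prod.emeasure_PiM) auto

lemma sets_lebn_box: "(\<And>i. i < n \<Longrightarrow> A i \<in> sets borel) \<Longrightarrow> PiE {..<n} A \<in> sets (lebn n)"
  unfolding lebn_def by (intro sets_PiM_I_finite) auto

text \<open>A product measure is determined by its values on boxes, so a one-dimensional affine
  substitution in each coordinate suffices.\<close>

lemma lebn_affine:
  assumes c: "0 < c"
  shows "scale_measure (ennreal (c ^ n)) (distr (lebn n) (lebn n) (\<lambda>x. \<lambda>i\<in>{..<n}. t i + c * x i)) = lebn n"
    (is "scale_measure _ (distr _ _ ?T) = _")
proof -
  have T: "?T \<in> measurable (lebn n) (lebn n)"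
    unfolding lebn_def by measurable
  have "scale_measure (ennreal (c ^ n)) (distr (lebn n) (lebn n) ?T) = PiM {..<n} (\<lambda>_. lborel)"
  proof (rule lborel_prod.PiM_eqI)
    show "sets (scale_measure (ennreal (c ^ n)) (distr (lebn n) (lebn n) ?T)) = sets (PiM {..<n} (\<lambda>_. lborel))"
      by (simp add: lebn_def)
    fix A :: "nat \<Rightarrow> real set" assume A: "\<And>i. i \<in> {..<n} \<Longrightarrow> A i \<in> sets lborel"
    have one: "emeasure lborel (A i) = ennreal c * emeasure lborel ((\<lambda>x. t i + c * x) -` A i)" if "i < n" for i
    proof -
      have Ai: "A i \<in> sets borel" using A that by simp
      have "emeasure lborel (A i) = (\<integral>\<^sup>+x. indicator (A i) x \<partial>lborel)"
        using Ai by simp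
      also have "\<dots> = ennreal c * (\<integral>\<^sup>+x. indicator (A i) (t i + c * x) \<partial>lborel)"
        using Ai c by (subst nn_integral_real_affine[where c = c and t = "t i"]) auto
      also have "(\<lambda>x. indicator (A i) (t i + c * x) :: ennreal) = indicator ((\<lambda>x. t i + c * x) -` A i)"
        by (auto simp: indicator_def)
      also have "(\<integral>\<^sup>+x. indicator ((\<lambda>x. t i + c * x) -` A i) x \<partial>lborel) = emeasure lborel ((\<lambda>x. t i + c * x) -` A i)"
      proof (rule nn_integral_indicator)
        have "(\<lambda>x. t i + c * x) \<in> borel_measurable borel" by simp
        from measurable_sets[OF this Ai] show "(\<lambda>x. t i + c * x) -` A i \<in> sets lborel" by simp
      qed
      finally show ?thesis .
    qed
    have pre: "?T -` PiE {..<n} A \<inter> space (lebn n) = PiE {..<n} (\<lambda>i. (\<lambda>x. t i + c * x) -` A i)"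
      by (auto simp: space_lebn PiE_def Pi_def)
    have "PiE {..<n} A \<in> sets (lebn n)" using A by (intro sets_lebn_box) auto
    then have "emeasure (scale_measure (ennreal (c ^ n)) (distr (lebn n) (lebn n) ?T)) (PiE {..<n} A)
        = ennreal (c ^ n) * emeasure (lebn n) (PiE {..<n} (\<lambda>i. (\<lambda>x. t i + c * x) -` A i))"
      using T by (simp add: emeasure_distr pre)
    also have "\<dots> = ennreal (c ^ n) * (\<Prod>i<n. emeasure lborel ((\<lambda>x. t i + c * x) -` A i))"
    proof (subst emeasure_lebn_box)
      fix i assume "i < n"
      have "(\<lambda>x. t i + c * x) \<in> borel_measurable borel" by simp
      from measurable_sets[OF this, of "A i"] show "(\<lambda>x. t i + c * x) -` A i \<in> sets borel"
        using A \<open>i < n\<close> by simp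
    qed simp
    also have "\<dots> = (\<Prod>i<n. ennreal c * emeasure lborel ((\<lambda>x. t i + c * x) -` A i))"
      using c by (simp add: prod.distrib ennreal_power)
    also have "\<dots> = (\<Prod>i<n. emeasure lborel (A i))"
      using one by (intro prod.cong) auto
    finally show "emeasure (scale_measure (ennreal (c ^ n)) (distr (lebn n) (lebn n) ?T)) (PiE {..<n} A)
        = (\<Prod>i\<in>{..<n}. emeasure lborel (A i))" .
  qed simp
  then show ?thesis by (simp add: lebn_def)
qed

lemma borel_measurable_blocknorm:
  assumes "valid_k n m k" "\<And>i. i < n \<Longrightarrow> (\<lambda>x. f x i) \<in> borel_measurable N"
  shows "(\<lambda>x. blocknorm p m k (f x)) \<in> borel_measurable N"
proof -
  have kle: "k j \<le> k m" if "j \<le> m" for j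
    using that assms(1) by (induction rule: inc_induct) (auto simp: valid_k_def intro: less_imp_le order_trans)
  have "(\<lambda>x. f x i) \<in> borel_measurable N" if "j < m" "i \<in> {k j..<k (Suc j)}" for i j
    using assms kle[of "Suc j"] that by (auto simp: valid_k_def)
  then show ?thesis
    unfolding blocknorm_def
    by (intro powr_real_measurable borel_measurable_sum borel_measurable_sqrt borel_measurable_power
        borel_measurable_const) auto
qed

lemma coord_measurable: "i < n \<Longrightarrow> (\<lambda>x. x i) \<in> borel_measurable (lebn n)"
  unfolding lebn_def by measurable

lemma sets_bball:
  assumes "valid_k n m k"
  shows "bball p n m k x r \<in> sets (lebn n)"
proof -
  have [measurable]: "(\<lambda>y. blocknorm p m k (\<lambda>i. y i - x i)) \<in> borel_measurable (lebn n)"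
    using assms coord_measurable by (intro borel_measurable_blocknorm) auto
  show ?thesis unfolding bball_def bdist_def by measurable
qed

text \<open>The ball is the affine image of the unit ball, which gives translation invariance and
  homogeneity of degree \<open>n\<close> at once.\<close>

lemma emeasure_bball:
  assumes p: "0 < p" and k: "valid_k n m k" and r: "0 < r"
  shows "emeasure (lebn n) (bball p n m k x r) = ennreal (r ^ n) * emeasure (lebn n) (bball p n m k (origin n) 1)"
proof -
  let ?T = "\<lambda>y. \<lambda>i\<in>{..<n}. x i + r * y i"
  have T: "?T \<in> measurable (lebn n) (lebn n)"
    unfolding lebn_def by measurable
  have "blocknorm p m k (\<lambda>i. ?T y i - x i) = r * blocknorm p m k (\<lambda>i. y i - origin n i)" for y
  proof -
    have "blocknorm p m k (\<lambda>i. ?T y i - x i) = blocknorm p m k (\<lambda>i. r * (y i - origin n i))"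
      by (intro blocknorm_cong[OF p k]) (simp add: origin_def)
    then show ?thesis using blocknorm_scale[OF p] r by simp
  qed
  then have "?T -` bball p n m k x r \<inter> space (lebn n) = bball p n m k (origin n) 1"
    using r by (auto simp: bball_def bdist_def space_lebn)
  then show ?thesis
    by (subst lebn_affine[OF r, of n x, symmetric]) (simp add: emeasure_distr T sets_bball[OF k])
qed

lemma emeasure_unit_bball_finite:
  assumes p: "0 < p" and k: "valid_k n m k"
  shows "emeasure (lebn n) (bball p n m k (origin n) 1) < \<infinity>"
proof -
  have "bball p n m k (origin n) 1 \<subseteq> PiE {..<n} (\<lambda>_. {-1..1})"
  proof
    fix y assume y: "y \<in> bball p n m k (origin n) 1"
    have "y i \<in> {-1..1}" if "i < n" for i
      using abs_coord_le_blocknorm[OF p k that, of "\<lambda>i. y i - origin n i"] y that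
      by (auto simp: bball_def bdist_def origin_def)
    then show "y \<in> PiE {..<n} (\<lambda>_. {-1..1})"
      using y by (auto simp: bball_def space_lebn PiE_def)
  qed
  then have "emeasure (lebn n) (bball p n m k (origin n) 1) \<le> emeasure (lebn n) (PiE {..<n} (\<lambda>_. {-1..1}))"
    by (intro emeasure_mono sets_lebn_box) auto
  also have "\<dots> < \<infinity>" by (subst emeasure_lebn_box) (auto simp: ennreal_power[symmetric] power_less_top_ennreal)
  finally show ?thesis .
qed

lemma emeasure_unit_bball_pos:
  assumes p: "0 < p" and k: "valid_k n m k"
  shows "0 < emeasure (lebn n) (bball p n m k (origin n) 1)"
proof -
  \<comment> \<open>Scaled so that a cube of side \<open>b\<close> fits in the unit ball; the
    \<open>+ 1\<close> keeps the denominator positive.\<close>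
  define b where "b = 1 / (blocknorm p m k (\<lambda>_. 1) + 1)"
  have b: "0 < b" "b * blocknorm p m k (\<lambda>_. 1) \<le> 1"
    using blocknorm_nonneg[of p m k "\<lambda>_. 1"] by (simp_all add: b_def)
  have "PiE {..<n} (\<lambda>_. {0..b}) \<subseteq> bball p n m k (origin n) 1"
  proof
    fix y :: "nat \<Rightarrow> real" assume y: "y \<in> PiE {..<n} (\<lambda>_. {0..b})"
    have "blocknorm p m k (\<lambda>i. y i - origin n i) \<le> blocknorm p m k (\<lambda>i. b * 1)"
    proof (rule blocknorm_mono[OF p k])
      fix i assume i: "i < n"
      then have "y i \<in> {0..b}" using PiE_mem[OF y, of i] by simp
      then show "\<bar>y i - origin n i\<bar> \<le> \<bar>b * 1\<bar>" using i b by (auto simp: origin_def)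
    qed
    also have "\<dots> = b * blocknorm p m k (\<lambda>i. 1)" using blocknorm_scale[OF p, of m k b "\<lambda>_. 1"] b by simp
    also have "\<dots> \<le> 1" by (rule b)
    finally show "y \<in> bball p n m k (origin n) 1"
      using y by (auto simp: bball_def bdist_def space_lebn PiE_def)
  qed
  then have "emeasure (lebn n) (PiE {..<n} (\<lambda>_. {0..b})) \<le> emeasure (lebn n) (bball p n m k (origin n) 1)"
    by (intro emeasure_mono sets_bball k)
  moreover have "0 < emeasure (lebn n) (PiE {..<n} (\<lambda>_. {0..b}))"
    using b by (subst emeasure_lebn_box) (auto simp: ennreal_power)
  ultimately show ?thesis by simp
qed

lemma bvol_bball_scale:
  assumes "0 < p" "valid_k n m k" "0 < r"
  shows "bvol n (bball p n m k x r) = r ^ n * bvol n (bball p n m k (origin n) 1)"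
  using emeasure_bball[OF assms, of x] assms(3) by (simp add: bvol_def measure_def enn2real_mult)

lemma bvol_unit_pos:
  assumes "0 < p" "valid_k n m k"
  shows "0 < bvol n (bball p n m k (origin n) 1)"
  using emeasure_unit_bball_pos[OF assms] emeasure_unit_bball_finite[OF assms]
  by (simp add: bvol_def measure_def enn2real_positive_iff)

text \<open>By homogeneity the volume condition is a pure power equation in the radius. Its positive
  root is unique, so the definite description in \<open>rad\<close> is meaningful.\<close>

lemma rad:
  assumes "0 < p" "valid_k n m k" "1 \<le> n"
  shows "0 < rad p n m k" "bvol n (bball p n m k (origin n) (rad p n m k)) = 1"
proof -
  let ?w = "bvol n (bball p n m k (origin n) 1)"
  have w: "0 < ?w" by (rule bvol_unit_pos[OF assms(1,2)])
  have eq: "0 < r \<and> bvol n (bball p n m k (origin n) r) = 1 \<longleftrightarrow> r = root n (1 / ?w)" for r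
  proof
    assume r: "0 < r \<and> bvol n (bball p n m k (origin n) r) = 1"
    then have "r ^ n = 1 / ?w" using bvol_bball_scale[OF assms(1,2), of r "origin n"] w by (simp add: field_simps)
    then show "r = root n (1 / ?w)" using r assms(3) real_root_power_cancel[of n r] by simp
  next
    assume r: "r = root n (1 / ?w)"
    then have "0 < r" "r ^ n = 1 / ?w" using assms(3) w by simp_all
    then show "0 < r \<and> bvol n (bball p n m k (origin n) r) = 1"
      using bvol_bball_scale[OF assms(1,2), of r "origin n"] w by simp
  qed
  have "rad p n m k = root n (1 / ?w)" unfolding rad_def by (rule the_equality) (use eq in blast)+
  then show "0 < rad p n m k" "bvol n (bball p n m k (origin n) (rad p n m k)) = 1" using eq by blast+
qed

text \<open>Volumes in units of \<open>rad\<close>, the form in which cardinalities of grid sets are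
  estimated.\<close>

lemma bvol_bball:
  assumes "0 < p" "valid_k n m k" "1 \<le> n" "0 < s"
  shows "bvol n (bball p n m k x (s * rad p n m k)) = s ^ n"
  using rad[OF assms(1-3)] assms bvol_bball_scale[OF assms(1,2), of "rad p n m k" "origin n"]
    bvol_bball_scale[OF assms(1,2), of "s * rad p n m k" x]
  by (simp add: power_mult_distrib)

lemma emeasure_bball_finite:
  assumes "0 < p" "valid_k n m k"
  shows "emeasure (lebn n) (bball p n m k x r) < \<infinity>"
proof (cases "0 < r")
  case True
  then show ?thesis using emeasure_bball[OF assms True, of x] emeasure_unit_bball_finite[OF assms]
    by (simp add: ennreal_mult_less_top)
next
  case False
  have "emeasure (lebn n) (bball p n m k x r) \<le> emeasure (lebn n) (bball p n m k x 1)"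
    using False by (intro emeasure_mono sets_bball assms) (auto simp: bball_def)
  also have "\<dots> < \<infinity>" using emeasure_bball[OF assms, of 1 x] emeasure_unit_bball_finite[OF assms] by simp
  finally show ?thesis .
qed

section \<open>Grid cells and lattice point counts\<close>

definition pt :: "real \<Rightarrow> (nat \<Rightarrow> int) \<Rightarrow> nat \<Rightarrow> real" where
  "pt \<epsilon> c = (\<lambda>i. \<epsilon> * of_int (c i))"

text \<open>Half-open cubes, so that every point lies in exactly one cell;
  \<open>pt \<epsilon> c\<close> is the lower corner.\<close>

definition cell :: "nat \<Rightarrow> real \<Rightarrow> (nat \<Rightarrow> int) \<Rightarrow> (nat \<Rightarrow> real) set" where
  "cell n \<epsilon> c = PiE {..<n} (\<lambda>i. {\<epsilon> * of_int (c i)..<\<epsilon> * (of_int (c i) + 1)})"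

lemma sets_cell: "cell n \<epsilon> c \<in> sets (lebn n)"
  unfolding cell_def by (intro sets_lebn_box) auto

lemma emeasure_cell: "0 < \<epsilon> \<Longrightarrow> emeasure (lebn n) (cell n \<epsilon> c) = ennreal (\<epsilon> ^ n)"
  unfolding cell_def by (subst emeasure_lebn_box) (auto simp: algebra_simps ennreal_power)

lemma cell_coord:
  assumes "x \<in> cell n \<epsilon> c" "i < n"
  shows "\<epsilon> * of_int (c i) \<le> x i" "x i < \<epsilon> * (of_int (c i) + 1)"
  using PiE_mem[OF assms(1)[unfolded cell_def], of i] assms(2) by simp_all

lemma cell_disjoint:
  assumes "0 < \<epsilon>" "c \<in> extensional {..<n}" "d \<in> extensional {..<n}" "x \<in> cell n \<epsilon> c" "x \<in> cell n \<epsilon> d"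
  shows "c = d"
proof (rule extensionalityI[OF assms(2,3)])
  have fl: "\<lfloor>x i / \<epsilon>\<rfloor> = e i" if "x \<in> cell n \<epsilon> e" "i < n" for e i
    using cell_coord[OF that] assms(1)
    by (intro floor_unique) (simp_all add: pos_le_divide_eq pos_divide_less_eq mult.commute)
  fix i assume "i \<in> {..<n}"
  then show "c i = d i" using fl[of c] fl[of d] assms by simp
qed

lemma ex_cell:
  assumes "0 < \<epsilon>" "x \<in> space (lebn n)"
  obtains c where "c \<in> extensional {..<n}" "x \<in> cell n \<epsilon> c"
proof
  let ?c = "\<lambda>i\<in>{..<n}. \<lfloor>x i / \<epsilon>\<rfloor>"
  show "?c \<in> extensional {..<n}" by simp
  have "of_int \<lfloor>x i / \<epsilon>\<rfloor> * \<epsilon> \<le> x i" "x i < (of_int \<lfloor>x i / \<epsilon>\<rfloor> + 1) * \<epsilon>" for i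
    using floor_correct[of "x i / \<epsilon>"] unfolding pos_le_divide_eq[OF assms(1), symmetric]
      pos_divide_less_eq[OF assms(1), symmetric] by simp_all
  then have "\<epsilon> * of_int \<lfloor>x i / \<epsilon>\<rfloor> \<le> x i" "x i < \<epsilon> * (of_int \<lfloor>x i / \<epsilon>\<rfloor> + 1)" for i
    by (simp_all only: mult.commute[of \<epsilon>])
  then show "x \<in> cell n \<epsilon> ?c"
    using assms(2) by (auto simp: cell_def PiE_def space_lebn)
qed

text \<open>The multiple \<open>\<epsilon>\<close> of the all-ones vector dominates all
  displacements from the corner; its norm plays the part of the cell diameter from here on.\<close>

lemma cell_near:
  assumes p: "0 < p" and k: "valid_k n m k" and e: "0 < \<epsilon>" and x: "x \<in> cell n \<epsilon> c"
  shows "blocknorm p m k (\<lambda>i. x i - pt \<epsilon> c i) \<le> \<epsilon> * blocknorm p m k (\<lambda>_. 1)"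
proof -
  have "blocknorm p m k (\<lambda>i. x i - pt \<epsilon> c i) \<le> blocknorm p m k (\<lambda>i. \<epsilon> * 1)"
  proof (rule blocknorm_mono[OF p k])
    fix i assume "i < n"
    then show "\<bar>x i - pt \<epsilon> c i\<bar> \<le> \<bar>\<epsilon> * 1\<bar>"
      using cell_coord[OF x, of i] e by (simp add: pt_def distrib_left)
  qed
  then show ?thesis using blocknorm_scale[OF p, of m k \<epsilon> "\<lambda>_. 1"] e by simp
qed

lemma measure_UN_cells:
  assumes "0 < \<epsilon>" "finite C" "C \<subseteq> extensional {..<n}"
  shows "emeasure (lebn n) (\<Union>c\<in>C. cell n \<epsilon> c) = ennreal (real (card C) * \<epsilon> ^ n)"
proof -
  have "emeasure (lebn n) (\<Union>c\<in>C. cell n \<epsilon> c) = (\<Sum>c\<in>C. emeasure (lebn n) (cell n \<epsilon> c))"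
    using assms sets_cell
    by (intro sum_emeasure[symmetric])
      (auto simp: disjoint_family_on_def subset_eq dest: cell_disjoint[OF assms(1), rotated 2])
  also have "\<dots> = ennreal (real (card C) * \<epsilon> ^ n)"
    using assms by (simp add: emeasure_cell ennreal_mult ennreal_of_nat_eq_real_of_nat)
  finally show ?thesis .
qed

text \<open>The cells at these grid points are disjoint, have volume \<open>\<epsilon> ^ n\<close>
  each, and fit into the ball enlarged by one cell diameter.\<close>

lemma card_grid_le:
  assumes p: "1 \<le> p" and k: "valid_k n m k" and e: "0 < \<epsilon>"
    and C: "finite C" "C \<subseteq> extensional {..<n}"
    and near: "\<And>c. c \<in> C \<Longrightarrow> blocknorm p m k (\<lambda>i. pt \<epsilon> c i - z i) \<le> s"
  shows "real (card C) * \<epsilon> ^ n \<le> bvol n (bball p n m k z (s + \<epsilon> * blocknorm p m k (\<lambda>_. 1)))"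
    (is "_ \<le> bvol n ?B")
proof -
  have "(\<Union>c\<in>C. cell n \<epsilon> c) \<subseteq> ?B"
  proof
    fix x assume "x \<in> (\<Union>c\<in>C. cell n \<epsilon> c)"
    then obtain c where c: "c \<in> C" "x \<in> cell n \<epsilon> c" by auto
    have "blocknorm p m k (\<lambda>i. x i - z i)
        = blocknorm p m k (\<lambda>i. (x i - pt \<epsilon> c i) + (pt \<epsilon> c i - z i))" by simp
    also have "\<dots> \<le> \<epsilon> * blocknorm p m k (\<lambda>_. 1) + s"
      using cell_near[OF _ k e c(2), of p] near[OF c(1)] p
      by (intro order_trans[OF blocknorm_triangle[OF p]] add_mono) auto
    finally show "x \<in> ?B"
      using c(2) by (auto simp: bball_def bdist_def space_lebn cell_def PiE_def add.commute)
  qed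
  then have "emeasure (lebn n) (\<Union>c\<in>C. cell n \<epsilon> c) \<le> emeasure (lebn n) ?B"
    by (intro emeasure_mono sets_bball k)
  then have "ennreal (real (card C) * \<epsilon> ^ n) \<le> ennreal (bvol n ?B)"
    unfolding measure_UN_cells[OF e C] bvol_def
    using emeasure_bball_finite[OF _ k, of p] p by (simp add: emeasure_eq_ennreal_measure less_top[symmetric])
  then show ?thesis by (simp add: bvol_def)
qed

definition grid :: "real \<Rightarrow> nat \<Rightarrow> nat \<Rightarrow> (nat \<Rightarrow> nat) \<Rightarrow> real \<Rightarrow> real \<Rightarrow> (nat \<Rightarrow> int) set" where
  "grid p n m k \<epsilon> s = {c \<in> extensional {..<n}. blocknorm p m k (pt \<epsilon> c) \<le> s}"

text \<open>The volume estimate bounds the cardinality of every finite subset uniformly.\<close>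

lemma finite_grid:
  assumes p: "1 \<le> p" and k: "valid_k n m k" and e: "0 < \<epsilon>"
  shows "finite (grid p n m k \<epsilon> s)"
proof -
  define v where "v = bvol n (bball p n m k (\<lambda>_. 0) (s + \<epsilon> * blocknorm p m k (\<lambda>_. 1)))"
  have "card C \<le> nat \<lfloor>v / \<epsilon> ^ n\<rfloor>" if "C \<subseteq> grid p n m k \<epsilon> s" "finite C" for C
  proof -
    have "real (card C) * \<epsilon> ^ n \<le> v"
      unfolding v_def using that by (intro card_grid_le[OF p k e]) (auto simp: grid_def)
    then have "real (card C) \<le> v / \<epsilon> ^ n" using e by (simp add: pos_le_divide_eq)
    then show ?thesis by linarith
  qed
  then show ?thesis using finite_if_finite_subsets_card_bdd by blast
qed

text \<open>The cell of a point of the ball has its corner within one diameter of that point, so the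
  cells of the slightly larger grid cover the ball.\<close>

lemma card_grid_ge:
  assumes p: "1 \<le> p" and k: "valid_k n m k" and e: "0 < \<epsilon>"
  shows "bvol n (bball p n m k (origin n) s)
    \<le> real (card (grid p n m k \<epsilon> (s + \<epsilon> * blocknorm p m k (\<lambda>_. 1)))) * \<epsilon> ^ n"
    (is "_ \<le> real (card ?G) * _")
proof -
  have G: "finite ?G" "?G \<subseteq> extensional {..<n}" using finite_grid[OF p k e] by (auto simp: grid_def)
  have "bball p n m k (origin n) s \<subseteq> (\<Union>c\<in>?G. cell n \<epsilon> c)"
  proof
    fix x assume x: "x \<in> bball p n m k (origin n) s"
    then obtain c where c: "c \<in> extensional {..<n}" "x \<in> cell n \<epsilon> c"
      using ex_cell[OF e] by (auto simp: bball_def)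
    have "blocknorm p m k (pt \<epsilon> c) = blocknorm p m k (\<lambda>i. (pt \<epsilon> c i - x i) + (x i - origin n i))"
      using p by (intro blocknorm_cong[OF _ k]) (auto simp: origin_def)
    also have "\<dots> \<le> \<epsilon> * blocknorm p m k (\<lambda>_. 1) + s"
      using cell_near[OF _ k e c(2), of p] x p blocknorm_minus_commute[of p m k "pt \<epsilon> c" x]
      by (intro order_trans[OF blocknorm_triangle[OF p]] add_mono) (auto simp: bball_def bdist_def)
    finally show "x \<in> (\<Union>c\<in>?G. cell n \<epsilon> c)" using c by (auto simp: grid_def add.commute)
  qed
  then have "emeasure (lebn n) (bball p n m k (origin n) s) \<le> emeasure (lebn n) (\<Union>c\<in>?G. cell n \<epsilon> c)"
    using sets_cell G by (intro emeasure_mono sets.finite_UN) auto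
  then have "ennreal (bvol n (bball p n m k (origin n) s)) \<le> ennreal (real (card ?G) * \<epsilon> ^ n)"
    unfolding measure_UN_cells[OF e G] bvol_def
    using emeasure_bball_finite[OF _ k, of p] p by (simp add: emeasure_eq_ennreal_measure less_top[symmetric])
  then show ?thesis using e by simp
qed

section \<open>The partition function\<close>

lemma sigma_finite_lebn: "sigma_finite_measure (lebn n)"
  unfolding lebn_def by (rule lborel_prod.sigma_finite) simp

lemma emeasure_lebn_power_box:
  fixes t :: nat
  assumes "\<And>i. i < t \<Longrightarrow> A i \<in> sets (lebn n)"
  shows "emeasure (PiM {..<t} (\<lambda>_. lebn n)) (PiE {..<t} A) = (\<Prod>i<t. emeasure (lebn n) (A i))"
proof -
  interpret product_sigma_finite "\<lambda>_::nat. lebn n"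
    by (simp add: product_sigma_finite_def sigma_finite_lebn)
  show ?thesis using assms by (subst emeasure_PiM) auto
qed

lemma sets_lebn_power_box:
  fixes t :: nat
  shows "(\<And>i. i < t \<Longrightarrow> A i \<in> sets (lebn n)) \<Longrightarrow> PiE {..<t} A \<in> sets (PiM {..<t} (\<lambda>_. lebn n))"
  by (intro sets_PiM_I_finite) auto

definition packings :: "real \<Rightarrow> nat \<Rightarrow> nat \<Rightarrow> (nat \<Rightarrow> nat) \<Rightarrow> (nat \<Rightarrow> real) set \<Rightarrow> nat \<Rightarrow> (nat \<Rightarrow> nat \<Rightarrow> real) set" where
  "packings p n m k S t = {xs \<in> space (PiM {..<t} (\<lambda>_. lebn n)).
           (\<forall>i<t. xs i \<in> S) \<and>
           (\<forall>i<t. \<forall>j<t. i \<noteq> j \<longrightarrow> bdist p m k (xs i) (xs j) \<ge> 2 * rad p n m k)}"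

lemma Zhat_packings:
  "Zhat p n m k S t = (if t = 0 then 1 else measure (PiM {..<t} (\<lambda>_. lebn n)) (packings p n m k S t) / fact t)"
  by (simp add: Zhat_def packings_def)

lemma sets_packings:
  assumes k: "valid_k n m k" and S: "S \<in> sets (lebn n)"
  shows "packings p n m k S t \<in> sets (PiM {..<t} (\<lambda>_. lebn n))"
proof -
  let ?P = "PiM {..<t} (\<lambda>_. lebn n)"
  have comp: "(\<lambda>xs. xs i l) \<in> borel_measurable ?P" if "i < t" "l < n" for i l
  proof -
    have "(\<lambda>xs. xs i) \<in> measurable ?P (lebn n)" using that by (intro measurable_component_singleton) auto
    from measurable_compose[OF this coord_measurable[OF that(2)]] show ?thesis .
  qed
  have "(\<lambda>xs. bdist p m k (xs i) (xs j)) \<in> borel_measurable ?P" if "i < t" "j < t" for i j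
    unfolding bdist_def using comp that by (intro borel_measurable_blocknorm[OF k] borel_measurable_diff) auto
  then have d: "{xs \<in> space ?P. 2 * rad p n m k \<le> bdist p m k (xs i) (xs j)} \<in> sets ?P" if "i < t" "j < t" for i j
    using that by measurable
  have s: "{xs \<in> space ?P. xs i \<in> S} \<in> sets ?P" if "i < t" for i
  proof -
    have "(\<lambda>xs. xs i) \<in> measurable ?P (lebn n)" using that by (intro measurable_component_singleton) auto
    from measurable_sets[OF this S] show ?thesis by (simp add: vimage_def Int_def conj_commute)
  qed
  have 1: "space ?P \<inter> (\<Inter>i\<in>I. B i) \<in> sets ?P"
    if "finite I" "\<And>i. i \<in> I \<Longrightarrow> B i \<in> sets ?P" for I and B :: "'b \<Rightarrow> _"
    using that by (induction I rule: finite_induct) (auto simp: Int_left_commute)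
  have "packings p n m k S t = (space ?P \<inter> (\<Inter>i\<in>{..<t}. {xs \<in> space ?P. xs i \<in> S})) \<inter>
     (space ?P \<inter> (\<Inter>ij\<in>{ij \<in> {..<t} \<times> {..<t}. fst ij \<noteq> snd ij}. {xs \<in> space ?P. 2 * rad p n m k \<le> bdist p m k (xs (fst ij)) (xs (snd ij))})) "
    unfolding packings_def by auto
  moreover have "\<dots> \<in> sets ?P"
    by (intro sets.Int 1) (auto intro: s d)
  ultimately show ?thesis by simp
qed

lemma packings_emeasure_le:
  assumes S: "S \<in> sets (lebn n)" "emeasure (lebn n) S < \<infinity>"
  shows "emeasure (PiM {..<t} (\<lambda>_. lebn n)) (packings p n m k S t) \<le> ennreal (bvol n S ^ t)"
proof -
  have "packings p n m k S t \<subseteq> PiE {..<t} (\<lambda>_. S)"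
    by (auto simp: packings_def space_PiM PiE_def)
  then have "emeasure (PiM {..<t} (\<lambda>_. lebn n)) (packings p n m k S t)
      \<le> emeasure (PiM {..<t} (\<lambda>_. lebn n)) (PiE {..<t} (\<lambda>_. S))"
    using S by (intro emeasure_mono sets_lebn_power_box) auto
  also have "\<dots> = emeasure (lebn n) S ^ t" using S by (subst emeasure_lebn_power_box) auto
  also have "\<dots> = ennreal (bvol n S ^ t)"
    using S by (simp add: bvol_def emeasure_eq_ennreal_measure less_top[symmetric] ennreal_power)
  finally show ?thesis .
qed

lemma Zhat_nonneg: "0 \<le> Zhat p n m k S t"
  by (simp add: Zhat_def)

lemma Zhat_le:
  assumes "S \<in> sets (lebn n)" "emeasure (lebn n) S < \<infinity>"
  shows "Zhat p n m k S t \<le> bvol n S ^ t / fact t"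
proof -
  have "measure (PiM {..<t} (\<lambda>_. lebn n)) (packings p n m k S t) \<le> bvol n S ^ t"
    unfolding measure_def using packings_emeasure_le[OF assms]
    by (intro enn2real_leI) (auto simp: bvol_def)
  then show ?thesis by (auto simp: Zhat_packings divide_right_mono)
qed

text \<open>Domination by an exponential series; it ensures that the infinite sum in
  \<open>Zpart\<close> is a genuine one.\<close>

lemma summable_Zpart:
  assumes "S \<in> sets (lebn n)" "emeasure (lebn n) S < \<infinity>" "0 \<le> lam"
  shows "summable (\<lambda>t. lam ^ t * Zhat p n m k S t)"
proof (rule summable_comparison_test')
  show "summable (\<lambda>t. inverse (fact t) * (lam * bvol n S) ^ t)" by (rule summable_exp)
  fix t :: nat
  have "lam ^ t * Zhat p n m k S t \<le> lam ^ t * (bvol n S ^ t / fact t)"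
    using assms by (intro mult_left_mono Zhat_le) auto
  then show "norm (lam ^ t * Zhat p n m k S t) \<le> inverse (fact t) * (lam * bvol n S) ^ t"
    using assms Zhat_nonneg[of p n m k S t] by (simp add: power_mult_distrib divide_inverse mult_ac)
qed

lemma Zpart_ge_1:
  assumes "S \<in> sets (lebn n)" "emeasure (lebn n) S < \<infinity>" "0 \<le> lam"
  shows "1 \<le> Zpart p n m k S lam"
proof -
  have "(\<Sum>t\<in>{0}. lam ^ t * Zhat p n m k S t) \<le> Zpart p n m k S lam"
    unfolding Zpart_def using assms Zhat_nonneg by (intro sum_le_suminf summable_Zpart) auto
  then show ?thesis by (simp add: Zhat_def)
qed

section \<open>Enumerations of finite sets\<close>

lemma card_bijections:
  assumes "finite S" "finite T" "card S = card T"
  shows "card {f \<in> S \<rightarrow>\<^sub>E T. inj_on f S} = fact (card S)"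
proof -
  obtain g where g: "bij_betw g T S" using assms finite_same_card_bij by metis
  define g' where "g' = inv_into T g"
  have g': "bij_betw g' S T" unfolding g'_def by (rule bij_betw_inv_into[OF g])
  have gg: "g (g' x) = x" if "x \<in> S" for x using g that by (simp add: g'_def bij_betw_inv_into_right)
  have gg': "g' (g x) = x" if "x \<in> T" for x using g that by (simp add: g'_def bij_betw_inv_into_left)
  \<comment> \<open>Composition with the fixed bijection \<open>g'\<close> turns permutations of
    \<open>S\<close> into bijections onto \<open>T\<close>, which are the injections because the
    cardinalities agree.\<close>
  have "bij_betw (\<lambda>\<pi>. restrict (g' \<circ> \<pi>) S) {\<pi>. \<pi> permutes S} {f \<in> S \<rightarrow>\<^sub>E T. inj_on f S}"
  proof (rule bij_betw_byWitness[where f' = "\<lambda>f x. if x \<in> S then g (f x) else x"])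
    show "\<forall>\<pi>\<in>{\<pi>. \<pi> permutes S}. (\<lambda>x. if x \<in> S then g (restrict (g' \<circ> \<pi>) S x) else x) = \<pi>"
      using gg permutes_in_image permutes_not_in by (fastforce simp: fun_eq_iff)
    show "\<forall>f\<in>{f \<in> S \<rightarrow>\<^sub>E T. inj_on f S}. restrict (g' \<circ> (\<lambda>x. if x \<in> S then g (f x) else x)) S = f"
    proof
      fix f assume f: "f \<in> {f \<in> S \<rightarrow>\<^sub>E T. inj_on f S}"
      show "restrict (g' \<circ> (\<lambda>x. if x \<in> S then g (f x) else x)) S = f"
        using f gg' by (intro extensionalityI[of _ S]) (auto simp: PiE_def Pi_def)
    qed
    show "(\<lambda>\<pi>. restrict (g' \<circ> \<pi>) S) ` {\<pi>. \<pi> permutes S} \<subseteq> {f \<in> S \<rightarrow>\<^sub>E T. inj_on f S}"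
    proof clarify
      fix \<pi> assume "\<pi> permutes S"
      then have "bij_betw (g' \<circ> \<pi>) S T" using g' permutes_imp_bij bij_betw_trans by blast
      then have "restrict (g' \<circ> \<pi>) S ` S = T" "inj_on (restrict (g' \<circ> \<pi>) S) S"
        by (auto simp: bij_betw_def inj_on_def)
      then show "restrict (g' \<circ> \<pi>) S \<in> S \<rightarrow>\<^sub>E T \<and> inj_on (restrict (g' \<circ> \<pi>) S) S"
        by (auto simp: PiE_def)
    qed
    show "(\<lambda>f x. if x \<in> S then g (f x) else x) ` {f \<in> S \<rightarrow>\<^sub>E T. inj_on f S} \<subseteq> {\<pi>. \<pi> permutes S}"
    proof clarify
      fix f assume f: "f \<in> S \<rightarrow>\<^sub>E T" "inj_on f S"
      have "f ` S = T" using f assms by (intro card_subset_eq) (auto simp: card_image)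
      then have "bij_betw (\<lambda>x. g (f x)) S S"
        using bij_betw_trans[of f S T g S] f g by (simp add: bij_betw_def o_def)
      then have "bij_betw (\<lambda>x. if x \<in> S then g (f x) else x) S S"
        by (rule bij_betw_cong[THEN iffD1, rotated]) simp
      then show "(\<lambda>x. if x \<in> S then g (f x) else x) permutes S"
        by (rule bij_imp_permutes) simp
    qed
  qed
  then have "card {f \<in> S \<rightarrow>\<^sub>E T. inj_on f S} = card {\<pi>. \<pi> permutes S}"
    by (simp add: bij_betw_same_card)
  then show ?thesis using card_permutations[OF refl assms(1)] by simp
qed

text \<open>Every set of size \<open>t\<close> has \<open>fact t\<close> enumerations; this cancels
  the division by \<open>fact t\<close> in \<open>Zhat\<close>.\<close>

lemma card_inj_images:
  assumes "finite \<A>" "\<And>A. A \<in> \<A> \<Longrightarrow> finite A \<and> card A = t"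
  shows "card {f. f \<in> extensional {..<t} \<and> inj_on f {..<t} \<and> f ` {..<t} \<in> \<A>} = card \<A> * fact t"
    and "finite {f. f \<in> extensional {..<t} \<and> inj_on f {..<t} \<and> f ` {..<t} \<in> \<A>}"
proof -
  have eq: "{f. f \<in> extensional {..<t} \<and> inj_on f {..<t} \<and> f ` {..<t} \<in> \<A>}
     = (\<Union>A\<in>\<A>. {f \<in> {..<t} \<rightarrow>\<^sub>E A. inj_on f {..<t}})" (is "?L = ?R")
  proof
    show "?L \<subseteq> ?R" by (auto simp: PiE_def)
    show "?R \<subseteq> ?L"
    proof clarify
      fix A f assume f: "A \<in> \<A>" "f \<in> {..<t} \<rightarrow>\<^sub>E A" "inj_on f {..<t}"
      have "f ` {..<t} = A" using f assms(2)[OF f(1)] by (intro card_subset_eq) (auto simp: card_image)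
      then show "f \<in> extensional {..<t} \<and> inj_on f {..<t} \<and> f ` {..<t} \<in> \<A>"
        using f by (auto simp: PiE_def)
    qed
  qed
  have fin: "finite {f \<in> {..<t} \<rightarrow>\<^sub>E A. inj_on f {..<t}}" if "A \<in> \<A>" for A
    using assms(2)[OF that] by (intro finite_subset[OF _ finite_PiE[of "{..<t}" "\<lambda>_. A"]]) auto
  show "finite ?L" unfolding eq using assms(1) fin by auto
  have dis: "{f \<in> {..<t} \<rightarrow>\<^sub>E A. inj_on f {..<t}} \<inter> {f \<in> {..<t} \<rightarrow>\<^sub>E B. inj_on f {..<t}} = {}"
    if "A \<in> \<A>" "B \<in> \<A>" "A \<noteq> B" for A B
  proof -
    have img: "f ` {..<t} = C" if "C \<in> \<A>" "f \<in> {..<t} \<rightarrow>\<^sub>E C" "inj_on f {..<t}" for f C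
      using that assms(2)[OF that(1)] by (intro card_subset_eq) (auto simp: card_image)
    have False if "f \<in> {..<t} \<rightarrow>\<^sub>E A" "f \<in> {..<t} \<rightarrow>\<^sub>E B" "inj_on f {..<t}" for f
      using img[OF \<open>A \<in> \<A>\<close> that(1,3)] img[OF \<open>B \<in> \<A>\<close> that(2,3)] \<open>A \<noteq> B\<close> by simp
    then show ?thesis by (intro equals0I) (simp, metis)
  qed
  have "card ?L = (\<Sum>A\<in>\<A>. card {f \<in> {..<t} \<rightarrow>\<^sub>E A. inj_on f {..<t}})"
    unfolding eq using assms(1) fin dis by (intro card_UN_disjoint) auto
  also have "\<dots> = (\<Sum>A\<in>\<A>. fact t)"
    using assms(2) by (intro sum.cong refl) (subst card_bijections, auto)
  finally show "card ?L = card \<A> * fact t" by simp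
qed

text \<open>Each enumeration of a set in \<open>\<A>\<close> contributes a product of cells of
  volume \<open>(\<epsilon> ^ n) ^ t\<close>. Distinct enumerations give disjoint products. All
  their points are admissible, since moving two grid points within their cells changes the distance
  by at most two diameters.\<close>

lemma Zhat_ge_grid:
  assumes p: "1 \<le> p" and k: "valid_k n m k" and e: "0 < \<epsilon>"
    and S: "S \<in> sets (lebn n)" "emeasure (lebn n) S < \<infinity>"
    and C: "finite C" "C \<subseteq> extensional {..<n}" "\<And>c. c \<in> C \<Longrightarrow> cell n \<epsilon> c \<subseteq> S"
    and \<A>: "\<And>A. A \<in> \<A> \<Longrightarrow> A \<subseteq> C \<and> card A = t"
      "\<And>A a b. A \<in> \<A> \<Longrightarrow> a \<in> A \<Longrightarrow> b \<in> A \<Longrightarrow> a \<noteq> b \<Longrightarrow>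
         2 * rad p n m k + 2 * (\<epsilon> * blocknorm p m k (\<lambda>_. 1)) \<le> bdist p m k (pt \<epsilon> a) (pt \<epsilon> b)"
    and t: "t \<noteq> 0"
  shows "real (card \<A>) * (\<epsilon> ^ n) ^ t \<le> Zhat p n m k S t"
proof -
  let ?P = "PiM {..<t} (\<lambda>_. lebn n)"
  define F where "F = {f. f \<in> extensional {..<t} \<and> inj_on f {..<t} \<and> f ` {..<t} \<in> \<A>}"
  define W where "W f = PiE {..<t} (\<lambda>i. cell n \<epsilon> (f i))" for f :: "nat \<Rightarrow> nat \<Rightarrow> int"
  have "\<A> \<subseteq> Pow C" using \<A>(1) by auto
  then have fin\<A>: "finite \<A>" using C(1) by (auto intro: finite_subset)
  have cardA: "finite A \<and> card A = t" if "A \<in> \<A>" for A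
    using \<A>(1)[OF that] C(1) by (auto intro: finite_subset)
  have F: "card F = card \<A> * fact t" "finite F"
    unfolding F_def using card_inj_images[OF fin\<A> cardA] by simp_all
  have FC: "f i \<in> C" if "f \<in> F" "i < t" for f i using that \<A>(1) by (auto simp: F_def)
  have W: "W f \<in> sets ?P" for f unfolding W_def by (intro sets_lebn_power_box sets_cell)
  have emW: "emeasure ?P (W f) = ennreal ((\<epsilon> ^ n) ^ t)" for f
    unfolding W_def using e by (subst emeasure_lebn_power_box) (auto simp: sets_cell emeasure_cell ennreal_power)
  have disj: "disjoint_family_on W F"
    unfolding disjoint_family_on_def
  proof (intro ballI impI)
    fix f g assume fg: "f \<in> F" "g \<in> F" "f \<noteq> g"
    show "W f \<inter> W g = {}"
    proof (rule ccontr)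
      assume "W f \<inter> W g \<noteq> {}"
      then obtain xs where xs: "xs \<in> W f" "xs \<in> W g" by auto
      have "f i = g i" if "i < t" for i
      proof (rule cell_disjoint[OF e, of _ n])
        show "xs i \<in> cell n \<epsilon> (f i)" "xs i \<in> cell n \<epsilon> (g i)"
          using PiE_mem[OF xs(1)[unfolded W_def], of i] PiE_mem[OF xs(2)[unfolded W_def], of i] that by auto
        show "f i \<in> extensional {..<n}" "g i \<in> extensional {..<n}" using FC that fg C(2) by blast+
      qed
      then have "f = g" using fg by (intro extensionalityI[of f "{..<t}" g]) (auto simp: F_def)
      then show False using fg by simp
    qed
  qed
  have sub: "(\<Union>f\<in>F. W f) \<subseteq> packings p n m k S t"
  proof clarify
    fix f xs assume f: "f \<in> F" and xs: "xs \<in> W f"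
    have xc: "xs i \<in> cell n \<epsilon> (f i)" if "i < t" for i
      using PiE_mem[OF xs[unfolded W_def], of i] that by simp
    have "xs \<in> space ?P" using sets.sets_into_space[OF W] xs by blast
    moreover have "xs i \<in> S" if "i < t" for i using xc[OF that] C(3)[OF FC[OF f that]] by blast
    moreover have "2 * rad p n m k \<le> bdist p m k (xs i) (xs j)" if ij: "i < t" "j < t" "i \<noteq> j" for i j
    proof -
      let ?h = "\<epsilon> * blocknorm p m k (\<lambda>_. 1)"
      let ?a = "pt \<epsilon> (f i)" and ?b = "pt \<epsilon> (f j)"
      have "f i \<noteq> f j" using f ij by (auto simp: F_def inj_on_def)
      then have "2 * rad p n m k + 2 * ?h \<le> bdist p m k ?a ?b"
        using \<A>(2)[of "f ` {..<t}" "f i" "f j"] f ij by (auto simp: F_def)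
      also have "\<dots> = blocknorm p m k (\<lambda>l. (xs i l - ?a l) + ((xs j l - xs i l) + (?b l - xs j l)))"
        by (simp add: bdist_def)
      also have "\<dots> \<le> blocknorm p m k (\<lambda>l. xs i l - ?a l) +
          (blocknorm p m k (\<lambda>l. xs j l - xs i l) + blocknorm p m k (\<lambda>l. ?b l - xs j l))"
        using blocknorm_triangle[OF p] by (meson add_left_mono order_trans)
      also have "\<dots> \<le> ?h + (bdist p m k (xs i) (xs j) + ?h)"
        using cell_near[OF _ k e xc[OF ij(1)], of p] cell_near[OF _ k e xc[OF ij(2)], of p] p
          blocknorm_minus_commute[of p m k ?b "xs j"]
        by (simp add: bdist_def)
      finally show ?thesis by simp
    qed
    ultimately show "xs \<in> packings p n m k S t" by (simp add: packings_def)
  qed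
  have "ennreal (real (card F) * (\<epsilon> ^ n) ^ t) = (\<Sum>f\<in>F. emeasure ?P (W f))"
    using e by (simp add: emW ennreal_mult ennreal_of_nat_eq_real_of_nat)
  also have "\<dots> = emeasure ?P (\<Union>f\<in>F. W f)"
    using W F disj by (intro sum_emeasure) auto
  also have "\<dots> \<le> emeasure ?P (packings p n m k S t)"
    by (intro emeasure_mono sub sets_packings k S)
  also have "\<dots> = ennreal (measure ?P (packings p n m k S t))"
    using packings_emeasure_le[OF S, of t p m k]
    by (intro emeasure_eq_ennreal_measure) (auto simp: top_unique)
  finally have "real (card F) * (\<epsilon> ^ n) ^ t \<le> measure ?P (packings p n m k S t)" by simp
  then have "fact t * (real (card \<A>) * (\<epsilon> ^ n) ^ t) \<le> measure ?P (packings p n m k S t)"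
    by (simp add: F mult_ac)
  then show ?thesis using t by (simp add: Zhat_packings pos_le_divide_eq mult.commute)
qed

text \<open>Count each edge at its endpoint with the larger value of \<open>f\<close>. The factor 2
  accounts for both orientations; ties are merely counted twice.\<close>

lemma sum_neighbours_le_ranked:
  fixes f :: "'a \<Rightarrow> real"
  assumes T: "finite T" and sym: "\<And>a b. E a b \<Longrightarrow> E b a"
    and K: "\<And>u. u \<in> T \<Longrightarrow> real (card {w\<in>T. E u w \<and> f w \<le> f u}) \<le> K"
  shows "real (\<Sum>u\<in>T. card (T \<inter> {x. E u x})) \<le> 2 * K * real (card T)"
proof -
  have "real (card (T \<inter> {x. E u x})) \<le> real (card {w\<in>T. E u w \<and> f w \<le> f u}) + real (card {w\<in>T. E u w \<and> f u \<le> f w})" for u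
  proof -
    have "card (T \<inter> {x. E u x}) \<le> card ({w\<in>T. E u w \<and> f w \<le> f u} \<union> {w\<in>T. E u w \<and> f u \<le> f w})"
      using T by (intro card_mono) auto
    also have "\<dots> \<le> card {w\<in>T. E u w \<and> f w \<le> f u} + card {w\<in>T. E u w \<and> f u \<le> f w}"
      by (rule card_Un_le)
    finally show ?thesis by simp
  qed
  then have "real (\<Sum>u\<in>T. card (T \<inter> {x. E u x})) \<le>
     (\<Sum>u\<in>T. real (card {w\<in>T. E u w \<and> f w \<le> f u})) + (\<Sum>u\<in>T. real (card {w\<in>T. E u w \<and> f u \<le> f w}))"
    by (simp add: sum.distrib[symmetric] sum_mono)
  also have "(\<Sum>u\<in>T. real (card {w\<in>T. E u w \<and> f u \<le> f w})) = (\<Sum>u\<in>T. \<Sum>w\<in>T. if E u w \<and> f u \<le> f w then 1 else 0)"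
    using T by (simp add: sum.inter_filter[symmetric])
  also have "\<dots> = (\<Sum>w\<in>T. \<Sum>u\<in>T. if E w u \<and> f u \<le> f w then 1 else 0)"
    using sym by (subst sum.swap) (intro sum.cong refl if_cong; blast)
  also have "\<dots> = (\<Sum>w\<in>T. real (card {u\<in>T. E w u \<and> f u \<le> f w}))"
    using T by (simp add: sum.inter_filter[symmetric])
  finally have "real (\<Sum>u\<in>T. card (T \<inter> {x. E u x})) \<le> 2 * (\<Sum>u\<in>T. real (card {w\<in>T. E u w \<and> f w \<le> f u}))"
    by simp
  also have "\<dots> \<le> 2 * (\<Sum>u\<in>T. K)" using K by (intro mult_left_mono sum_mono) auto
  finally show ?thesis by (simp add: mult_ac)
qed

text \<open>The inequality is strict, so that non-adjacency is exactly the separation demanded in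
  \<open>Zhat_ge_grid\<close>.\<close>

definition close :: "real \<Rightarrow> nat \<Rightarrow> (nat \<Rightarrow> nat) \<Rightarrow> real \<Rightarrow> real \<Rightarrow> (nat \<Rightarrow> int) \<Rightarrow> (nat \<Rightarrow> int) \<Rightarrow> bool" where
  "close p m k \<epsilon> \<delta> a b \<longleftrightarrow> bdist p m k (pt \<epsilon> a) (pt \<epsilon> b) < \<delta>"

lemma hardcore_close:
  assumes "0 < p" "0 < \<delta>" shows "hardcore_graph (close p m k \<epsilon> \<delta>)"
proof
  show "close p m k \<epsilon> \<delta> a a" for a
    using assms blocknorm_scale[of p m k 0 "\<lambda>_. 0"] by (simp add: close_def bdist_def)
  show "close p m k \<epsilon> \<delta> b a" if "close p m k \<epsilon> \<delta> a b" for a b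
    using that blocknorm_minus_commute[OF assms(1), of m k "pt \<epsilon> a" "pt \<epsilon> b"] by (simp add: close_def bdist_def)
qed

text \<open>Comparison term by term: independent sets of size \<open>t\<close> bound
  \<open>Zhat\<close> from below, and the cell volume turns \<open>lam\<close> into
  \<open>lam * \<epsilon> ^ n\<close>. The radius \<open>R - h\<close> keeps the cells inside the
  ball.\<close>

lemma Zpart_ge_grid_graph:
  assumes p: "1 \<le> p" and k: "valid_k n m k" and n: "1 \<le> n" and e: "0 < \<epsilon>" and lam: "0 \<le> lam"
    and h: "h = \<epsilon> * blocknorm p m k (\<lambda>_. 1)"
  shows "hardcore_graph.Z (close p m k \<epsilon> (2 * rad p n m k + 2 * h)) (grid p n m k \<epsilon> (R - h)) (lam * \<epsilon> ^ n)
     \<le> Zpart p n m k (bball p n m k (origin n) R) lam"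
proof -
  have p0: "0 < p" using p by simp
  let ?S = "bball p n m k (origin n) R"
  let ?V = "grid p n m k \<epsilon> (R - h)"
  let ?E = "close p m k \<epsilon> (2 * rad p n m k + 2 * h)"
  let ?\<mu> = "lam * \<epsilon> ^ n"
  have h0: "0 \<le> h" using e blocknorm_nonneg[of p m k "\<lambda>_. 1"] by (simp add: h)
  interpret hardcore_graph ?E
    using rad(1)[OF p0 k n] h0 p0 by (intro hardcore_close) auto
  have V: "finite ?V" "?V \<subseteq> extensional {..<n}" using finite_grid[OF p k e] by (auto simp: grid_def)
  have S: "?S \<in> sets (lebn n)" "emeasure (lebn n) ?S < \<infinity>"
    by (intro sets_bball k emeasure_bball_finite p0)+
  have cellS: "cell n \<epsilon> c \<subseteq> ?S" if c: "c \<in> ?V" for c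
  proof
    fix x assume x: "x \<in> cell n \<epsilon> c"
    have "blocknorm p m k (\<lambda>i. x i - origin n i) = blocknorm p m k (\<lambda>i. (x i - pt \<epsilon> c i) + pt \<epsilon> c i)"
      by (intro blocknorm_cong[OF p0 k]) (simp add: origin_def)
    also have "\<dots> \<le> h + (R - h)"
      using cell_near[OF p0 k e x] c unfolding h
      by (intro order_trans[OF blocknorm_triangle[OF p]] add_mono) (simp_all add: grid_def)
    finally show "x \<in> ?S"
      using x by (auto simp: bball_def bdist_def space_lebn cell_def PiE_def)
  qed
  have slice: "(\<Sum>A\<in>{A\<in>indep_sets ?V. card A = t}. ?\<mu> ^ card A) \<le> lam ^ t * Zhat p n m k ?S t" for t
  proof (cases "t = 0")
    case True
    have "{A\<in>indep_sets ?V. card A = 0} = {{}}"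
      using indep_sets_finite[OF V(1)] empty_indep by auto
    then show ?thesis using True by (simp add: Zhat_def)
  next
    case False
    have "real (card {A\<in>indep_sets ?V. card A = t}) * (\<epsilon> ^ n) ^ t \<le> Zhat p n m k ?S t"
      using False cellS
      by (intro Zhat_ge_grid[OF p k e S V])
        (auto simp: indep_sets_def close_def h[symmetric] not_less)
    then have "lam ^ t * (real (card {A\<in>indep_sets ?V. card A = t}) * (\<epsilon> ^ n) ^ t) \<le> lam ^ t * Zhat p n m k ?S t"
      using lam by (intro mult_left_mono) auto
    then show ?thesis by (simp add: power_mult_distrib mult_ac)
  qed
  have "Z ?V ?\<mu> = (\<Sum>t\<in>{..card ?V}. \<Sum>A\<in>{A\<in>indep_sets ?V. card A = t}. ?\<mu> ^ card A)"
    unfolding Z_def using V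
    by (intro sum.group[symmetric] finite_indep_sets) (auto simp: indep_sets_def intro: card_mono)
  also have "\<dots> \<le> (\<Sum>t\<in>{..card ?V}. lam ^ t * Zhat p n m k ?S t)"
    by (intro sum_mono slice)
  also have "\<dots> \<le> Zpart p n m k ?S lam"
    unfolding Zpart_def using lam Zhat_nonneg
    by (intro sum_le_suminf summable_Zpart S) auto
  finally show ?thesis .
qed

section \<open>The bound at finite radius\<close>

lemma one_plus_power_le_exp: "0 \<le> x \<Longrightarrow> (1 + x) ^ n \<le> exp (real n * x)" for x :: real
  using power_mono[of "1 + x" "exp x" n] by (simp add: exp_of_nat_mult)

text \<open>Application of \<open>ln_Z_ge\<close> to the grid graph. The factor
  \<open>(1 - 2 * h / R) ^ n\<close> is the loss at the boundary of the ball, and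
  \<open>exp (- 1 / real n)\<close> is the price of the discretisation in the degree bound.\<close>

lemma ln_Zpart_ge:
  assumes p: "1 < p" and k: "valid_k n m k" and n: "1 \<le> n"
    and b: "1 / 2 \<le> \<beta>" "\<beta> < 1"
    and uc: "\<And>x y \<rho>. 0 \<le> \<rho> \<Longrightarrow> blocknorm p m k x \<le> \<rho> \<Longrightarrow> blocknorm p m k y \<le> \<rho> \<Longrightarrow>
      \<rho> / 2 \<le> blocknorm p m k (\<lambda>i. x i - y i) \<Longrightarrow>
      blocknorm p m k (\<lambda>i. (x i + y i) / 2) \<le> \<beta> * \<rho>"
    and lam: "0 < lam" and L: "L = ln (lam * 2 ^ n)" "0 \<le> L"
    and th: "\<theta> \<le> 1 - lam * (2 * exp 2 * (2 * \<beta>) ^ n)" "0 < \<theta>" "\<theta> \<le> 1"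
    and B: "0 \<le> L\<^sup>2 / 2 - L * ln (1 + L)"
    and h: "h = rad p n m k * (2 / (3 * (real n)\<^sup>2))" and R: "2 * h < R"
  shows "(1 - 2 * h / R) ^ n * (exp (- 1 / real n) / 2 ^ n * \<theta> * (L\<^sup>2 / 2 - L * ln (1 + L)))
     \<le> ln (Zpart p n m k (bball p n m k (origin n) R) lam) / bvol n (bball p n m k (origin n) R)"
proof -
  have p0: "0 < p" and p1: "1 \<le> p" using p by auto
  define r where "r = rad p n m k"
  have r: "0 < r" unfolding r_def by (rule rad[OF p0 k n])
  \<comment> \<open>The cell diameter in units of \<open>rad\<close>, so small that enlarging the
    radius \<open>2\<close> to \<open>2 + 3 * \<tau>\<close> raises the volume by a factor of at
    most \<open>exp (1 / real n)\<close>.\<close>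
  define \<tau> where "\<tau> = 2 / (3 * (real n)\<^sup>2)"
  have tau: "0 < \<tau>" and nt: "real n * (3 * \<tau> / 2) = 1 / real n" "real n * (2 * \<tau>) \<le> 2"
  proof -
    show "0 < \<tau>" using n by (simp add: \<tau>_def)
    show "real n * (3 * \<tau> / 2) = 1 / real n" using n by (simp add: \<tau>_def power2_eq_square)
    moreover have "1 / real n \<le> 1" using n by simp
    ultimately show "real n * (2 * \<tau>) \<le> 2" by simp
  qed
  have hr: "h = \<tau> * r" by (simp add: h r_def \<tau>_def)
  have h0: "0 < h" using hr r tau by simp
  define b1 where "b1 = blocknorm p m k (\<lambda>_. 1)"
  have b1: "1 \<le> b1" using abs_coord_le_blocknorm[OF p0 k, of 0 "\<lambda>_. 1"] n by (simp add: b1_def)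
  define \<epsilon> where "\<epsilon> = h / b1"
  have e: "0 < \<epsilon>" using h0 b1 by (simp add: \<epsilon>_def)
  have heb: "h = \<epsilon> * blocknorm p m k (\<lambda>_. 1)" using b1 by (simp add: \<epsilon>_def b1_def[symmetric])
  define \<delta> where "\<delta> = 2 * rad p n m k + 2 * h"
  have del: "0 < \<delta>" using r h0 by (simp add: \<delta>_def r_def)
  define V where "V = grid p n m k \<epsilon> (R - h)"
  define E where "E = close p m k \<epsilon> \<delta>"
  interpret hardcore_graph E unfolding E_def by (intro hardcore_close p0 del)
  have V: "finite V" "V \<subseteq> extensional {..<n}" using finite_grid[OF p1 k e] by (auto simp: V_def grid_def)
  define \<Delta> where "\<Delta> = 2 ^ n * exp (1 / real n) / \<epsilon> ^ n"
  have D0: "0 < \<Delta>" using e by (simp add: \<Delta>_def)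
  define K where "K = (2 * \<beta>) ^ n * exp 2 / \<epsilon> ^ n"
  \<comment> \<open>The \<open>\<tau>\<close> subtracted from \<open>s\<close> pays for the
    enlargement by one cell diameter in \<open>card_grid_le\<close>.\<close>
  have count: "real (card C) \<le> s ^ n / \<epsilon> ^ n"
    if "C \<subseteq> V" "\<And>c. c \<in> C \<Longrightarrow> blocknorm p m k (\<lambda>i. pt \<epsilon> c i - z i) \<le> (s - \<tau>) * r" "0 < s" for C z s
  proof -
    have "real (card C) * \<epsilon> ^ n \<le> bvol n (bball p n m k z ((s - \<tau>) * r + \<epsilon> * blocknorm p m k (\<lambda>_. 1)))"
      using that V by (intro card_grid_le[OF p1 k e]) (auto intro: finite_subset)
    also have "(s - \<tau>) * r + \<epsilon> * blocknorm p m k (\<lambda>_. 1) = s * rad p n m k"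
      by (simp add: heb[symmetric] hr r_def algebra_simps)
    also have "bvol n (bball p n m k z (s * rad p n m k)) = s ^ n"
      by (rule bvol_bball[OF p0 k n that(3)])
    finally show ?thesis using e by (simp add: pos_le_divide_eq)
  qed
  have deg: "real (card (V \<inter> {x. E v x})) \<le> \<Delta>" if "v \<in> V" for v
  proof -
    have "real (card (V \<inter> {x. E v x})) \<le> (2 + 3 * \<tau>) ^ n / \<epsilon> ^ n"
    proof (rule count)
      fix c assume "c \<in> V \<inter> {x. E v x}"
      then show "blocknorm p m k (\<lambda>i. pt \<epsilon> c i - pt \<epsilon> v i) \<le> (2 + 3 * \<tau> - \<tau>) * r"
        by (simp add: E_def close_def bdist_def \<delta>_def hr r_def algebra_simps)
    qed (use tau in auto)
    also have "(2 + 3 * \<tau>) ^ n = 2 ^ n * (1 + 3 * \<tau> / 2) ^ n"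
      by (simp add: power_mult_distrib[symmetric])
    also have "\<dots> \<le> 2 ^ n * exp (1 / real n)"
      using one_plus_power_le_exp[of "3 * \<tau> / 2" n] tau nt by (intro mult_left_mono) auto
    finally show ?thesis using e by (simp add: \<Delta>_def divide_right_mono)
  qed
  have sparse: "real (\<Sum>u\<in>T. card (T \<inter> {x. E u x})) \<le> 2 * K * real (card T)"
    if v: "v \<in> V" and T: "T \<subseteq> V \<inter> {x. E v x}" for v T
  proof (rule sum_neighbours_le_ranked[where f = "\<lambda>w. bdist p m k (pt \<epsilon> v) (pt \<epsilon> w)"])
    show "finite T" using T V by (auto intro: finite_subset)
    show "E b a" if "E a b" for a b using that by (rule E_sym)
    fix u assume u: "u \<in> T"
    let ?C = "{w \<in> T. E u w \<and> bdist p m k (pt \<epsilon> v) (pt \<epsilon> w) \<le> bdist p m k (pt \<epsilon> v) (pt \<epsilon> u)}"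
    \<comment> \<open>The power of this radius splits off \<open>(2 * \<beta>) ^ n\<close>; since
      \<open>1 \<le> 2 * \<beta>\<close>, it still leaves room for the extra
      \<open>\<tau>\<close>.\<close>
    let ?s = "2 * \<beta> * (1 + 2 * \<tau>)"
    have \<beta>\<delta>: "\<beta> * \<delta> \<le> (?s - \<tau>) * r"
    proof -
      have "\<tau> \<le> 2 * \<beta> * \<tau>" using b tau by simp
      then have "\<beta> * (2 + 2 * \<tau>) \<le> ?s - \<tau>" by (simp add: algebra_simps)
      then have "\<beta> * (2 + 2 * \<tau>) * r \<le> (?s - \<tau>) * r" using r by (intro mult_right_mono) auto
      then show ?thesis by (simp add: \<delta>_def hr r_def algebra_simps)
    qed
    \<comment> \<open>Counting every edge \<open>u w\<close> from the endpoint \<open>u\<close> farther from \<open>v\<close> confines \<open>w\<close> to a small ball: around \<open>v\<close> if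
      \<open>u\<close> is near \<open>v\<close>, and around the midpoint of \<open>u\<close> and \<open>v\<close> by uniform convexity otherwise.\<close>
    have "\<exists>z. \<forall>c\<in>?C. blocknorm p m k (\<lambda>i. pt \<epsilon> c i - z i) \<le> \<beta> * \<delta>"
    proof (cases "\<delta> / 2 \<le> bdist p m k (pt \<epsilon> v) (pt \<epsilon> u)")
      case False
      have "\<delta> / 2 \<le> \<beta> * \<delta>" using b del by simp
      then show ?thesis using False by (intro exI[of _ "pt \<epsilon> v"]) (auto simp: bdist_def)
    next
      case True
      have "blocknorm p m k (\<lambda>i. pt \<epsilon> c i - (pt \<epsilon> v i + pt \<epsilon> u i) / 2) \<le> \<beta> * \<delta>" if c: "c \<in> ?C" for c
      proof -
        have "blocknorm p m k (\<lambda>i. ((pt \<epsilon> c i - pt \<epsilon> v i) + (pt \<epsilon> c i - pt \<epsilon> u i)) / 2) \<le> \<beta> * \<delta>"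
        proof (rule uc)
          show "0 \<le> \<delta>" using del by simp
          show "blocknorm p m k (\<lambda>i. pt \<epsilon> c i - pt \<epsilon> v i) \<le> \<delta>"
            using c T by (auto simp: E_def close_def bdist_def)
          show "blocknorm p m k (\<lambda>i. pt \<epsilon> c i - pt \<epsilon> u i) \<le> \<delta>"
            using c by (auto simp: E_def close_def bdist_def)
          show "\<delta> / 2 \<le> blocknorm p m k (\<lambda>i. (pt \<epsilon> c i - pt \<epsilon> v i) - (pt \<epsilon> c i - pt \<epsilon> u i))"
            using True by (simp add: bdist_def)
        qed
        then show ?thesis by (simp add: field_simps)
      qed
      then show ?thesis by (intro exI[of _ "\<lambda>i. (pt \<epsilon> v i + pt \<epsilon> u i) / 2"]) auto
    qed
    then obtain z where z: "\<And>c. c \<in> ?C \<Longrightarrow> blocknorm p m k (\<lambda>i. pt \<epsilon> c i - z i) \<le> \<beta> * \<delta>" by blast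
    have "real (card ?C) \<le> ?s ^ n / \<epsilon> ^ n"
    proof (rule count)
      show "?C \<subseteq> V" using T by auto
      show "blocknorm p m k (\<lambda>i. pt \<epsilon> c i - z i) \<le> (?s - \<tau>) * r" if "c \<in> ?C" for c
        using z[OF that] \<beta>\<delta> by simp
      show "0 < ?s" using b tau by simp
    qed
    also have "?s ^ n = (2 * \<beta>) ^ n * (1 + 2 * \<tau>) ^ n" by (rule power_mult_distrib)
    also have "\<dots> \<le> (2 * \<beta>) ^ n * exp 2"
      using order_trans[OF one_plus_power_le_exp[of "2 * \<tau>" n], of "exp 2"] tau nt b
      by (intro mult_left_mono) auto
    finally show "real (card ?C) \<le> K" using e by (simp add: K_def divide_right_mono)
  qed
  let ?\<mu> = "exp L / \<Delta>"
  have eL: "exp L = lam * 2 ^ n" using L lam by simp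
  have mu: "?\<mu> = lam * \<epsilon> ^ n * exp (- 1 / real n)"
    using e by (simp add: eL \<Delta>_def exp_minus field_simps)
  \<comment> \<open>The factor \<open>exp (1 / real n)\<close> in \<open>\<Delta>\<close> puts
    \<open>exp L / \<Delta>\<close> slightly below the grid fugacity; monotonicity of
    \<open>Z\<close> bridges the difference.\<close>
  have mule: "?\<mu> \<le> lam * \<epsilon> ^ n"
    unfolding mu using lam e mult_left_mono[of "exp (- 1 / real n)" 1 "lam * \<epsilon> ^ n"] by simp
  have "?\<mu> * (2 * K) \<le> lam * \<epsilon> ^ n * (2 * K)"
    using mule b e by (intro mult_right_mono) (auto simp: K_def)
  also have "\<dots> = lam * (2 * exp 2 * (2 * \<beta>) ^ n)" using e by (simp add: K_def)
  finally have th': "\<theta> \<le> 1 - ?\<mu> * (2 * K)" using th(1) by simp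
  have "real (card V) / \<Delta> * \<theta> * (L\<^sup>2 / 2 - L * ln (1 + L)) \<le> ln (Z V ?\<mu>)"
    using b e by (intro ln_Z_ge[OF V(1) D0 L(2) deg sparse th' th(2,3)]) (auto simp: K_def)
  also have "\<dots> \<le> ln (Zpart p n m k (bball p n m k (origin n) R) lam)"
  proof (rule ln_mono)
    show "0 < Z V ?\<mu>" using Z_ge_1[OF V(1), of ?\<mu>] D0 by (simp add: order_less_le_trans[OF zero_less_one])
    have "Z V ?\<mu> \<le> Z V (lam * \<epsilon> ^ n)" using D0 mule by (intro Z_mono V) auto
    also have "\<dots> \<le> Zpart p n m k (bball p n m k (origin n) R) lam"
      unfolding V_def E_def \<delta>_def using Zpart_ge_grid_graph[OF p1 k n e _ heb, of lam R] lam by simp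
    finally show "Z V ?\<mu> \<le> Zpart p n m k (bball p n m k (origin n) R) lam" .
  qed
  finally have main: "real (card V) / \<Delta> * \<theta> * (L\<^sup>2 / 2 - L * ln (1 + L))
      \<le> ln (Zpart p n m k (bball p n m k (origin n) R) lam)" .
  have R0: "0 < R" using R h0 by simp
  have vol: "bvol n (bball p n m k (origin n) s) = (s / r) ^ n" if "0 < s" for s
    using bvol_bball[OF p0 k n, of "s / r" "origin n"] r that by (simp add: r_def[symmetric])
  \<comment> \<open>The grid has radius \<open>R - h\<close>, and \<open>card_grid_ge\<close> uses
    up one more cell diameter.\<close>
  have "((R - 2 * h) / r) ^ n \<le> real (card V) * \<epsilon> ^ n"
    using card_grid_ge[OF p1 k e, of "R - 2 * h"] vol[of "R - 2 * h"] R
    by (simp add: heb[symmetric] V_def)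
  also have "(R - 2 * h) / r = (1 - 2 * h / R) * (R / r)" using R0 r by (simp add: field_simps)
  finally have "(1 - 2 * h / R) ^ n * (R / r) ^ n \<le> real (card V) * \<epsilon> ^ n"
    by (simp only: power_mult_distrib)
  then have "(1 - 2 * h / R) ^ n \<le> real (card V) * \<epsilon> ^ n / (R / r) ^ n"
    using R0 r by (subst pos_le_divide_eq) auto
  then have "(1 - 2 * h / R) ^ n * (exp (- 1 / real n) / 2 ^ n * \<theta> * (L\<^sup>2 / 2 - L * ln (1 + L)))
     \<le> real (card V) * \<epsilon> ^ n / (R / r) ^ n * (exp (- 1 / real n) / 2 ^ n * \<theta> * (L\<^sup>2 / 2 - L * ln (1 + L)))"
    using th B by (intro mult_right_mono mult_nonneg_nonneg) auto
  also have "\<dots> = (real (card V) / \<Delta> * \<theta> * (L\<^sup>2 / 2 - L * ln (1 + L))) / (R / r) ^ n"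
    by (simp add: \<Delta>_def exp_minus field_simps)
  also have "\<dots> \<le> ln (Zpart p n m k (bball p n m k (origin n) R) lam) / (R / r) ^ n"
    using R0 r by (intro divide_right_mono main) auto
  finally show ?thesis using vol[OF R0] by simp
qed

section \<open>Passage to the pressure\<close>

lemma pressure_nonneg:
  assumes "0 < p" "valid_k n m k" "0 \<le> lam"
  shows "0 \<le> pressure p n m k lam"
  unfolding pressure_def
proof (rule Liminf_bounded, rule always_eventually, rule allI)
  fix R
  have "1 \<le> Zpart p n m k (bball p n m k (origin n) R) lam"
    using assms by (intro Zpart_ge_1 sets_bball emeasure_bball_finite)
  then show "0 \<le> ereal (ln (Zpart p n m k (bball p n m k (origin n) R) lam) / bvol n (bball p n m k (origin n) R))"
    by (simp add: bvol_def)
qed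

text \<open>The mesh does not depend on \<open>R\<close>, so the boundary factor tends to 1 as
  \<open>R\<close> grows.\<close>

lemma pressure_ge:
  assumes p: "1 < p" and k: "valid_k n m k" and n: "1 \<le> n"
    and b: "1 / 2 \<le> \<beta>" "\<beta> < 1"
    and uc: "\<And>x y \<rho>. 0 \<le> \<rho> \<Longrightarrow> blocknorm p m k x \<le> \<rho> \<Longrightarrow> blocknorm p m k y \<le> \<rho> \<Longrightarrow>
      \<rho> / 2 \<le> blocknorm p m k (\<lambda>i. x i - y i) \<Longrightarrow>
      blocknorm p m k (\<lambda>i. (x i + y i) / 2) \<le> \<beta> * \<rho>"
    and lam: "0 < lam" and L: "L = ln (lam * 2 ^ n)" "0 \<le> L"
    and th: "\<theta> \<le> 1 - lam * (2 * exp 2 * (2 * \<beta>) ^ n)" "0 < \<theta>" "\<theta> \<le> 1"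
    and B: "0 \<le> L\<^sup>2 / 2 - L * ln (1 + L)"
  shows "ereal (exp (- 1 / real n) / 2 ^ n * \<theta> * (L\<^sup>2 / 2 - L * ln (1 + L))) \<le> pressure p n m k lam"
proof -
  define C where "C = exp (- 1 / real n) / 2 ^ n * \<theta> * (L\<^sup>2 / 2 - L * ln (1 + L))"
  define h where "h = rad p n m k * (2 / (3 * (real n)\<^sup>2))"
  have "((\<lambda>R. 2 * h / R) \<longlongrightarrow> 0) at_top"
    by (intro tendsto_divide_0[OF tendsto_const] filterlim_at_top_imp_at_infinity filterlim_ident)
  then have "((\<lambda>R. (1 - 2 * h / R) ^ n * C) \<longlongrightarrow> (1 - 0) ^ n * C) at_top"
    by (intro tendsto_intros)
  then have "((\<lambda>R. ereal ((1 - 2 * h / R) ^ n * C)) \<longlongrightarrow> ereal C) at_top" by simp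
  then have "ereal C = Liminf at_top (\<lambda>R. ereal ((1 - 2 * h / R) ^ n * C))"
    by (rule lim_imp_Liminf[symmetric, rotated]) simp
  also have "\<dots> \<le> pressure p n m k lam"
    unfolding pressure_def
  proof (rule Liminf_mono)
    show "\<forall>\<^sub>F R in at_top. ereal ((1 - 2 * h / R) ^ n * C)
        \<le> ereal (ln (Zpart p n m k (bball p n m k (origin n) R) lam) / bvol n (bball p n m k (origin n) R))"
      using eventually_gt_at_top[of "2 * h"]
    proof eventually_elim
      case (elim R)
      show ?case
        unfolding C_def ereal_less_eq by (rule ln_Zpart_ge[OF p k n b uc lam L th B h_def elim])
    qed
  qed
  finally show ?thesis by (simp add: C_def)
qed

text \<open>Collects all errors in one subtracted term. As \<open>l \<le> 1\<close>, the logarithm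
  is at most \<open>ln (2 * real n)\<close>, and \<open>B \<le> (real n)\<^sup>2\<close> bounds the
  cost of the factors \<open>exp (- 1 / real n)\<close> and \<open>1 - d\<close>.\<close>

lemma pressure_bound_arith:
  fixes l d :: real and n :: nat
  assumes n: "1 \<le> n" and l: "0 < l" "l \<le> 1" and d: "0 \<le> d"
    and pos: "0 < l\<^sup>2 / 2 - (ln (2 * real n) / real n + 1 / real n + d)"
  defines "B \<equiv> (real n * l)\<^sup>2 / 2 - real n * l * ln (1 + real n * l)"
  shows "d < 1" "0 \<le> B"
    "(l\<^sup>2 / 2 - (ln (2 * real n) / real n + 1 / real n + d)) * (real n)\<^sup>2 \<le> exp (- 1 / real n) * (1 - d) * B"
proof -
  have l2: "l\<^sup>2 \<le> 1" using l by (simp add: power_le_one)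
  have ln0: "0 \<le> ln (2 * real n) / real n" using n by simp
  have n1: "0 \<le> 1 / real n" by simp
  show d1: "d < 1" using pos l2 ln0 n1 by linarith
  have "real n * l \<le> real n" "0 \<le> real n * l" using l n by simp_all
  then have "ln (1 + real n * l) \<le> ln (2 * real n)"
    using n by (intro ln_mono) linarith+
  then have "real n * l * ln (1 + real n * l) \<le> real n * l * ln (2 * real n)"
    using l by (intro mult_left_mono) auto
  also have "\<dots> \<le> real n * 1 * ln (2 * real n)"
    using l n by (intro mult_right_mono mult_left_mono) auto
  finally have "(real n * l)\<^sup>2 / 2 - real n * ln (2 * real n) \<le> B" by (simp add: B_def)
  moreover have "(real n * l)\<^sup>2 / 2 - real n * ln (2 * real n) = (l\<^sup>2 / 2 - ln (2 * real n) / real n) * (real n)\<^sup>2"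
    using n by (simp add: power2_eq_square field_simps)
  ultimately have B1: "(l\<^sup>2 / 2 - ln (2 * real n) / real n) * (real n)\<^sup>2 \<le> B" by simp
  have "0 \<le> (l\<^sup>2 / 2 - ln (2 * real n) / real n) * (real n)\<^sup>2"
    using pos d n1 by (intro mult_nonneg_nonneg zero_le_power2) linarith
  with B1 show B0: "0 \<le> B" by simp
  have "0 \<le> real n * l * ln (1 + real n * l)" using l by (intro mult_nonneg_nonneg ln_ge_zero) auto
  then have "B \<le> (real n)\<^sup>2 * (l\<^sup>2 / 2)" by (simp add: B_def power_mult_distrib)
  also have "\<dots> \<le> (real n)\<^sup>2 * 1" using l2 by (intro mult_left_mono) auto
  finally have Bn: "B \<le> (real n)\<^sup>2" by simp
  have "(1 / real n + d) * B \<le> (1 / real n + d) * (real n)\<^sup>2"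
    using Bn d n1 by (intro mult_left_mono) auto
  with B1 have "(l\<^sup>2 / 2 - (ln (2 * real n) / real n + 1 / real n + d)) * (real n)\<^sup>2 \<le> (1 - (1 / real n + d)) * B"
    by (simp add: algebra_simps)
  also have "\<dots> \<le> (exp (- 1 / real n) * (1 - d)) * B"
  proof (rule mult_right_mono[OF _ B0])
    have "(1 - 1 / real n) * (1 - d) \<le> exp (- 1 / real n) * (1 - d)"
      using exp_ge_add_one_self[of "- 1 / real n"] d1 by (intro mult_right_mono) auto
    moreover have "0 \<le> 1 / real n * d" using d by simp
    moreover have "(1 - a) * (1 - d) = 1 - (a + d) + a * d" for a by (simp add: algebra_simps)
    ultimately show "1 - (1 / real n + d) \<le> exp (- 1 / real n) * (1 - d)" by (smt (verit))
  qed
  finally show "(l\<^sup>2 / 2 - (ln (2 * real n) / real n + 1 / real n + d)) * (real n)\<^sup>2 \<le> exp (- 1 / real n) * (1 - d) * B" .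
qed

theorem theorem17:
  fixes p :: real
  assumes "1 < p" and "p \<le> 2"
  shows "\<exists>(c::real) (\<eta>::nat \<Rightarrow> real). 0 < c \<and> c < 2 \<and> \<eta> \<longlonglongrightarrow> 0 \<and>
    (\<forall>n m k (lam::real). 1 \<le> n \<longrightarrow> valid_k n m k \<longrightarrow>
       2 powr (- real n) < lam \<longrightarrow> lam \<le> c powr (- real n) \<longrightarrow>
       ereal ((((ln 2 + ln lam / real n)\<^sup>2) / 2 + \<eta> n) * (real n)\<^sup>2 / 2 ^ n)
         \<le> pressure p n m k lam)"
proof -
  obtain \<beta> where b: "1 / 2 \<le> \<beta>" "\<beta> < 1" and uc:
    "\<And>m k x y \<rho>. 0 \<le> \<rho> \<Longrightarrow> blocknorm p m k x \<le> \<rho> \<Longrightarrow> blocknorm p m k y \<le> \<rho> \<Longrightarrow>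
      \<rho> / 2 \<le> blocknorm p m k (\<lambda>i. x i - y i) \<Longrightarrow>
      blocknorm p m k (\<lambda>i. (x i + y i) / 2) \<le> \<beta> * \<rho>"
    using uniform_convexity_blocknorm[OF assms(1)] by blast
  \<comment> \<open>Strictly between \<open>2 * \<beta>\<close> and \<open>2\<close>, which makes
    \<open>q < 1\<close>, and at least \<open>1\<close>, which later gives
    \<open>lam \<le> 1\<close>.\<close>
  define c where "c = 1 + \<beta>"
  define q where "q = 2 * \<beta> / c"
  have q: "0 \<le> q" "q < 1" using b by (simp_all add: q_def c_def)
  \<comment> \<open>Bounds the correction for edges inside neighbourhoods for all admissible
    \<open>lam\<close> at once, and decays geometrically.\<close>
  define d where "d n = 2 * exp 2 * q ^ n" for n :: nat
  define \<eta> where "\<eta> n = - (ln (2 * real n) / real n + 1 / real n + d n)" for n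
  have "\<eta> \<longlonglongrightarrow> 0"
  proof -
    have "(\<lambda>n. - (ln 2 * (1 / real n) + ln (real n) / real n + 1 / real n + d n)) \<longlonglongrightarrow> - (ln 2 * 0 + 0 + 0 + 2 * exp 2 * 0)"
      unfolding d_def using q lim_ln_over_n lim_1_over_n
      by (intro tendsto_intros LIMSEQ_power_zero) auto
    moreover have "\<forall>\<^sub>F n in sequentially. - (ln 2 * (1 / real n) + ln (real n) / real n + 1 / real n + d n) = \<eta> n"
      using eventually_gt_at_top[of 0] by eventually_elim (simp add: \<eta>_def ln_mult add_divide_distrib)
    ultimately show ?thesis by (simp add: tendsto_cong)
  qed
  moreover have "ereal ((((ln 2 + ln lam / real n)\<^sup>2) / 2 + \<eta> n) * (real n)\<^sup>2 / 2 ^ n) \<le> pressure p n m k lam"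
    if n: "1 \<le> n" and k: "valid_k n m k" and lam1: "2 powr (- real n) < lam" and lam2: "lam \<le> c powr (- real n)"
    for n m k and lam :: real
  \<comment> \<open>If the claimed bound is not positive, nonnegativity of the pressure
    suffices.\<close>
  proof (cases "0 < (ln 2 + ln lam / real n)\<^sup>2 / 2 + \<eta> n")
    case False
    have "0 \<le> lam" using less_trans[OF _ lam1, of 0] by simp
    then have "0 \<le> pressure p n m k lam" using assms by (intro pressure_nonneg k) auto
    moreover have "(((ln 2 + ln lam / real n)\<^sup>2) / 2 + \<eta> n) * (real n)\<^sup>2 / 2 ^ n \<le> 0"
      using False by (intro divide_nonpos_pos mult_nonpos_nonneg) auto
    ultimately show ?thesis by (metis ereal_less_eq(3) order_trans zero_ereal_def)
  next
    case True
    \<comment> \<open>\<open>real n * l\<close> is the upper limit \<open>L\<close> of the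
      integration over the log-fugacity.\<close>
    define l where "l = ln 2 + ln lam / real n"
    have lam0: "0 < lam" using less_trans[OF _ lam1, of 0] by simp
    have "- real n * ln 2 < ln lam" using ln_less_cancel_iff[of "2 powr (- real n)" lam] lam1 lam0 by (simp add: ln_powr)
    then have l0: "0 < l" using n by (simp add: l_def field_simps)
    have "c powr (- real n) \<le> 1" using powr_mono[of "- real n" 0 c] b by (simp add: c_def)
    then have "ln lam \<le> 0" using lam2 lam0 by simp
    then have "ln lam / real n \<le> 0" by (simp add: divide_nonpos_nonneg)
    then have l1: "l \<le> 1" using ln_2_less_1 by (simp add: l_def)
    have nl: "real n * l = ln (lam * 2 ^ n)"
      using n lam0 by (simp add: l_def ln_mult ln_realpow field_simps)
    have d0: "0 \<le> d n" using q by (simp add: d_def)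
    have pos: "0 < l\<^sup>2 / 2 - (ln (2 * real n) / real n + 1 / real n + d n)"
      using True by (simp add: l_def \<eta>_def)
    note ar = pressure_bound_arith[OF n l0 l1 d0 pos]
    define B where "B = (real n * l)\<^sup>2 / 2 - real n * l * ln (1 + real n * l)"
    have cp: "c powr (- real n) = 1 / c ^ n"
      using b by (simp add: c_def powr_minus_divide powr_realpow)
    have "lam * (2 * exp 2 * (2 * \<beta>) ^ n) \<le> c powr (- real n) * (2 * exp 2 * (2 * \<beta>) ^ n)"
      by (rule mult_right_mono[OF lam2]) (use b in simp)
    also have "\<dots> = d n" unfolding cp d_def q_def power_divide by simp
    finally have th: "1 - d n \<le> 1 - lam * (2 * exp 2 * (2 * \<beta>) ^ n)" by simp
    have "ereal (exp (- 1 / real n) / 2 ^ n * (1 - d n) * B) \<le> pressure p n m k lam"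
      unfolding B_def using ar(1,2) d0 l0
      by (intro pressure_ge[OF assms(1) k n b uc lam0 nl _ th]) auto
    moreover have "((ln 2 + ln lam / real n)\<^sup>2 / 2 + \<eta> n) * (real n)\<^sup>2 / 2 ^ n \<le> exp (- 1 / real n) / 2 ^ n * (1 - d n) * B"
    proof -
      have "l\<^sup>2 / 2 - (ln (2 * real n) / real n + 1 / real n + d n) = (ln 2 + ln lam / real n)\<^sup>2 / 2 + \<eta> n"
        by (simp add: l_def \<eta>_def)
      from divide_right_mono[OF ar(3)[unfolded this, folded B_def], of "2 ^ n"] show ?thesis by simp
    qed
    ultimately show ?thesis by (meson ereal_less_eq(3) order_trans)
  qed
  ultimately show ?thesis using b by (intro exI[of _ c] exI[of _ \<eta>]) (auto simp: c_def)
qed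

end
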